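(* Let $P\subseteq\mathbb{R}^{p+q}$ be a rational polyhedron with $P_I\neq\emptyset$, let $cx+hy$ ($c\in\mathbb{Q}^p$, $h\in\mathbb{Q}^q$) be an objective function bounded above on $P$, let $\gamma^*=\max\{cx+hy:(x,y)\in P_I\}$ and $M=\{(x,y)\in P_I: cx+hy=\gamma^*\}$. If $\mathrm{relint}(\mathrm{proj}_X(M))\cap\mathbb{Z}^p\neq\emptyset$, then there exists $k\in\mathbb{N}$ with $\sup\{cx+hy:(x,y)\in P^{(k)}\}=\gamma^*$.
   Context: $P_I=\mathrm{conv}\{(x,y)\in P:x\in\mathbb{Z}^p\}$; $\mathrm{proj}_X(S)=\{x\in\mathbb{R}^p:\exists y,\ (x,y)\in S\}$; $\mathrm{relint}$ denotes relative interior. A split disjunction is a pair of inequalities $dx\le\delta$, $-dx\le-\delta-1$ with $d\in\mathbb{Z}^p$, $\delta\in\mathbb{Z}$ (a 2-disjunction). For a closed convex set $C\subseteq\mathbb{R}^{p+q}$, an inequality $\alpha x+\beta y\le\gamma$ is a split cut (2-disjunctive cut) for $C$ if it is not valid for $C$ and there exist $d\in\mathbb{Z}^p,\delta\in\mathbb{Z}$ such that every $(x,y)\in C$ with $\alpha x+\beta y>\gamma$ satisfies $\delta<dx<\delta+1$. The split closure of $C$ is the intersection of $C$ with all half-spaces given by split cuts for $C$; $P^{(0)}=P$ and $P^{(k)}$ is the split closure of $P^{(k-1)}$. *)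

theory Defs
  imports "HOL-Analysis.Analysis"
begin

text \<open>Points of R^(p+q) are modelled as vectors z :: real^'n; the set I of
coordinates is the set of integer-constrained (x-) coordinates, the remaining
coordinates are the continuous (y-) coordinates.  So p = card I, q = CARD('n) - card I.\<close>

definition rat_vec :: "real^'n \<Rightarrow> bool" where
  "rat_vec a \<longleftrightarrow> (\<forall>i. a $ i \<in> \<rat>)"

definition rational_polyhedron :: "(real^'n) set \<Rightarrow> bool" where
  "rational_polyhedron P \<longleftrightarrow>
     (\<exists>F. finite F \<and> (\<forall>(a, \<beta>) \<in> F. rat_vec a \<and> \<beta> \<in> \<rat>) \<and>
          P = {z. \<forall>(a, \<beta>) \<in> F. a \<bullet> z \<le> \<beta>})"

definition int_on :: "'n set \<Rightarrow> real^'n \<Rightarrow> bool" where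
  "int_on I z \<longleftrightarrow> (\<forall>i\<in>I. z $ i \<in> \<int>)"

definition mi_hull :: "'n set \<Rightarrow> (real^'n) set \<Rightarrow> (real^'n) set" where
  "mi_hull I P = convex hull {z \<in> P. int_on I z}"

text \<open>projection onto the x-coordinates (x embedded as the coordinate subspace)\<close>
definition proj_X :: "'n set \<Rightarrow> (real^'n) set \<Rightarrow> (real^'n) set" where
  "proj_X I S = (\<lambda>z. \<chi> i. if i \<in> I then z $ i else 0) ` S"

definition split_cut :: "'n set \<Rightarrow> (real^'n) set \<Rightarrow> real^'n \<Rightarrow> real \<Rightarrow> bool" where
  "split_cut I C \<alpha> \<gamma> \<longleftrightarrow>
     (\<exists>z\<in>C. \<alpha> \<bullet> z > \<gamma>) \<and>
     (\<exists>d \<delta>. (\<forall>i. if i \<in> I then d $ i \<in> \<int> else d $ i = 0) \<and> \<delta> \<in> \<int> \<and>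
        (\<forall>z\<in>C. \<alpha> \<bullet> z > \<gamma> \<longrightarrow> \<delta> < d \<bullet> z \<and> d \<bullet> z < \<delta> + 1))"

definition split_closure :: "'n set \<Rightarrow> (real^'n) set \<Rightarrow> (real^'n) set" where
  "split_closure I C = C \<inter> \<Inter>{{z. \<alpha> \<bullet> z \<le> \<gamma>} | \<alpha> \<gamma>. split_cut I C \<alpha> \<gamma>}"

definition split_iter :: "'n set \<Rightarrow> nat \<Rightarrow> (real^'n) set \<Rightarrow> (real^'n) set" where
  "split_iter I k P = (split_closure I ^^ k) P"

end

theory Submission
  imports Defs
begin

text \<open>
  Let \<open>x'\<close> be a point of \<open>M\<close> whose projection is integral and lies in the relative interior
  of the projection of \<open>M\<close>, and write \<open>s z = w \<bullet> z - \<gamma>\<close>. Rational linear programming duality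
  on the fibre of \<open>x'\<close> yields an integral form \<open>d\<close> in the integer variables and \<open>\<mu>0 > 0\<close> such
  that \<open>s \<le> \<mu>0 * u\<close> on \<open>P\<close>, where \<open>u z = d \<bullet> (z - x')\<close>; by the relative interior condition \<open>u\<close>
  vanishes on \<open>M\<close>. It remains to push the slope \<open>\<mu>0\<close> down to \<open>0\<close>.

  All mixed-integral points of \<open>P\<close> with \<open>s \<ge> 0\<close> satisfy \<open>u \<le> 0\<close>, so \<open>u \<le> 0\<close> has a finite
  Chvatal-Gomory derivation from the system of \<open>P\<close> and \<open>s \<ge> 0\<close>. If \<open>s \<le> \<mu> * u\<close> is already
  valid, each step of this derivation can be imitated by a split cut up to a multiple of the
  error term \<open>\<mu> * u - s \<ge> 0\<close>, and the result is \<open>u \<le> \<rho> * (\<mu> * u - s)\<close>, that is,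
  \<open>s \<le> (\<mu> - 1 / \<rho>) * u\<close>. As \<open>\<rho>\<close> does not depend on \<open>\<mu>\<close>, finitely many rounds suffice. The
  hypothesis \<open>s \<ge> 0\<close> is controlled by the error term only for \<open>\<mu>\<close> bounded away from \<open>\<mu>0\<close>;
  a first round relative to the face \<open>s = \<mu>0 * u\<close> achieves this.
\<close>

section \<open>Split closures\<close>

text \<open>The admissible split directions: their inner products with mixed-integral points are
  integers.\<close>

definition int_form :: "'n set \<Rightarrow> real^'n \<Rightarrow> bool" where
  "int_form I a \<longleftrightarrow> (\<forall>i. if i \<in> I then a $ i \<in> \<int> else a $ i = 0)"

lemma split_closure_subset: "split_closure I C \<subseteq> C"
  by (auto simp: split_closure_def)

lemma split_iter_0 [simp]: "split_iter I 0 C = C"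
  by (simp add: split_iter_def)

lemma split_iter_Suc: "split_iter I (Suc k) C = split_closure I (split_iter I k C)"
  by (simp add: split_iter_def)

lemma split_iter_add: "split_iter I (k + m) C = split_iter I m (split_iter I k C)"
  unfolding split_iter_def by (subst add.commute) (simp add: funpow_add)

lemma split_iter_subset: "split_iter I k C \<subseteq> C"
proof (induction k)
  case (Suc k)
  then show ?case
    using split_closure_subset[of I "split_iter I k C"] by (simp add: split_iter_Suc)
qed simp

lemma split_iter_antimono: "k \<le> m \<Longrightarrow> split_iter I m C \<subseteq> split_iter I k C"
  using split_iter_add[of I k "m - k" C] split_iter_subset by fastforce

text \<open>A point \<open>z\<close> violating the inequality is itself the witness of non-validity
  that \<open>split_cut\<close> demands, so the half-space is a genuine split cut and must contain
  \<open>z\<close>. Inequalities already valid on \<open>C\<close> thus form no separate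
  case.\<close>

lemma split_closure_le:
  assumes "int_form I d" "\<delta> \<in> \<int>"
    and "\<And>z. z \<in> C \<Longrightarrow> \<alpha> \<bullet> z > c \<Longrightarrow> \<delta> < d \<bullet> z \<and> d \<bullet> z < \<delta> + 1"
    and z: "z \<in> split_closure I C"
  shows "\<alpha> \<bullet> z \<le> c"
proof (rule ccontr)
  assume "\<not> \<alpha> \<bullet> z \<le> c"
  moreover from z have "z \<in> C"
    using split_closure_subset by blast
  ultimately have "split_cut I C \<alpha> c"
    using assms(1-3) unfolding split_cut_def int_form_def by (meson not_le)
  then have "z \<in> {z. \<alpha> \<bullet> z \<le> c}"
    using z by (auto simp: split_closure_def)
  with \<open>\<not> \<alpha> \<bullet> z \<le> c\<close> show False by simp
qed

lemma inner_int_form: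
  assumes "int_form I d" "int_on I z"
  shows "d \<bullet> z \<in> \<int>"
  unfolding inner_vec_def
proof (rule Ints_sum)
  fix i
  show "d $ i \<bullet> z $ i \<in> \<int>"
    using assms by (cases "i \<in> I") (auto simp: int_form_def int_on_def split: if_splits)
qed

lemma split_cutD:
  assumes "split_cut I C \<alpha> c" "z \<in> C" "\<alpha> \<bullet> z > c"
  shows "\<exists>d \<delta>. int_form I d \<and> \<delta> \<in> \<int> \<and> \<delta> < d \<bullet> z \<and> d \<bullet> z < \<delta> + 1"
  using assms unfolding split_cut_def int_form_def by blast

text \<open>No integer lies strictly between \<open>\<delta>\<close> and
  \<open>\<delta> + 1\<close>. This later keeps \<open>x'\<close> in every iterate and so bounds the
  supremum from below.\<close>

lemma int_on_in_split_closure: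
  assumes "z \<in> C" "int_on I z"
  shows "z \<in> split_closure I C"
proof -
  have "\<alpha> \<bullet> z \<le> c" if cut: "split_cut I C \<alpha> c" for \<alpha> c
  proof (rule ccontr)
    assume "\<not> \<alpha> \<bullet> z \<le> c"
    then obtain d \<delta> where d: "int_form I d" "\<delta> \<in> \<int>" "\<delta> < d \<bullet> z" "d \<bullet> z < \<delta> + 1"
      using split_cutD[OF cut assms(1)] by auto
    then show False
      using inner_int_form[OF d(1) assms(2)] by (auto elim!: Ints_cases)
  qed
  then show ?thesis
    using assms(1) by (auto simp: split_closure_def)
qed

lemma int_on_in_split_iter: "z \<in> C \<Longrightarrow> int_on I z \<Longrightarrow> z \<in> split_iter I k C"
  by (induction k) (auto simp: split_iter_Suc intro: int_on_in_split_closure)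

section \<open>Chvatal-Gomory derivations\<close>

definition sols :: "((real^'n) \<times> real) set \<Rightarrow> (real^'n) set" where
  "sols B = {z. \<forall>(a, \<beta>) \<in> B. a \<bullet> z \<le> \<beta>}"

lemma solsD: "z \<in> sols B \<Longrightarrow> (a, \<beta>) \<in> B \<Longrightarrow> a \<bullet> z \<le> \<beta>"
  by (auto simp: sols_def)

lemma solsI: "(\<And>a \<beta>. (a, \<beta>) \<in> B \<Longrightarrow> a \<bullet> z \<le> \<beta>) \<Longrightarrow> z \<in> sols B"
  by (auto simp: sols_def)

text \<open>The system is a parameter, so that slices, faces and level constraints can be adjoined
  to it. For \<open>I = {}\<close> only the zero form may be rounded, and \<open>der {}\<close> is
  linear inference, sound on all of \<open>sols B\<close>.\<close>

inductive der :: "'n set \<Rightarrow> ((real^'n) \<times> real) set \<Rightarrow> real^'n \<Rightarrow> real \<Rightarrow> bool"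
  for I B where
  base: "(a, \<beta>) \<in> B \<Longrightarrow> der I B a \<beta>"
| zero: "0 \<le> \<beta> \<Longrightarrow> der I B 0 \<beta>"
| add: "der I B a \<alpha> \<Longrightarrow> der I B b \<beta> \<Longrightarrow> der I B (a + b) (\<alpha> + \<beta>)"
| scale: "0 \<le> c \<Longrightarrow> der I B a \<alpha> \<Longrightarrow> der I B (c *\<^sub>R a) (c * \<alpha>)"
| round: "int_form I a \<Longrightarrow> der I B a \<alpha> \<Longrightarrow> der I B a (of_int \<lfloor>\<alpha>\<rfloor>)"

lemma der_weaken: "der I B a \<alpha> \<Longrightarrow> \<alpha> \<le> \<beta> \<Longrightarrow> der I B a \<beta>"
  using der.add[OF _ der.zero[of "\<beta> - \<alpha>"], of I B a \<alpha>] by simp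

lemma der_sound:
  assumes "der I B a \<alpha>" "z \<in> sols B" "int_on I z"
  shows "a \<bullet> z \<le> \<alpha>"
  using assms
proof induction
  case (round a \<alpha>)
  then show ?case
    using inner_int_form[of I a z] by (auto elim!: Ints_cases simp: le_floor_iff)
qed (auto simp: solsD inner_add_left mult_left_mono)

text \<open>A zero entry is an integer, so every rounding step allowed for \<open>J\<close> is
  allowed for the larger \<open>I\<close>. This transports derivations back from systems in which
  variables were fixed or eliminated.\<close>

lemma der_trans:
  assumes "der J B' a \<alpha>" "J \<subseteq> I" "\<And>b \<beta>. (b, \<beta>) \<in> B' \<Longrightarrow> der I B b \<beta>"
  shows "der I B a \<alpha>"
  using assms(1)
proof induction
  case (round a \<alpha>)
  then have "int_form I a"
    using assms(2) unfolding int_form_def by (metis Ints_0 subsetD)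
  then show ?case using round by (auto intro: der.round)
qed (auto intro: der.intros assms(3))

lemma der_sum:
  assumes "finite A" "\<And>a. a \<in> A \<Longrightarrow> 0 \<le> u a" "\<And>a. a \<in> A \<Longrightarrow> \<exists>\<beta>. der I B a \<beta>"
  shows "\<exists>\<beta>. der I B (\<Sum>a\<in>A. u a *\<^sub>R a) \<beta>"
  using assms
proof (induction A)
  case empty
  then show ?case by (auto intro!: der.zero exI[of _ 0])
next
  case (insert x A)
  then obtain \<alpha> \<beta> where "der I B x \<alpha>" "der I B (\<Sum>a\<in>A. u a *\<^sub>R a) \<beta>" by blast
  then have "der I B (u x *\<^sub>R x + (\<Sum>a\<in>A. u a *\<^sub>R a)) (u x * \<alpha> + \<beta>)"
    using insert.prems(1) by (intro der.add der.scale) auto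
  then show ?case using insert.hyps by auto
qed

text \<open>Rounding survives the presence of a nonnegative affine error term: the cut
\<open>a \<bullet> z \<le> \<lfloor>\<alpha>\<rfloor> + \<rho>' g z\<close> is a split cut for the split on \<open>a\<close> as soon as
\<open>\<rho>' \<ge> \<rho> / (1 - frac \<alpha>)\<close>.\<close>

lemma round_with_error:
  fixes g :: "real^'n"
  assumes "int_form I a" "0 \<le> \<rho>"
    and g: "\<And>z. z \<in> C \<Longrightarrow> 0 \<le> g \<bullet> z + g0"
    and le: "\<And>z. z \<in> C \<Longrightarrow> a \<bullet> z \<le> \<alpha> + \<rho> * (g \<bullet> z + g0)"
    and z: "z \<in> split_closure I C"
  shows "a \<bullet> z \<le> of_int \<lfloor>\<alpha>\<rfloor> + \<rho> / (1 - frac \<alpha>) * (g \<bullet> z + g0)"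
proof -
  define \<rho>' where "\<rho>' = \<rho> / (1 - frac \<alpha>)"
  define f where "f = frac \<alpha>"
  have f: "0 \<le> f" "f < 1" "\<alpha> = of_int \<lfloor>\<alpha>\<rfloor> + f"
    using frac_lt_1[of \<alpha>] frac_ge_0[of \<alpha>] by (auto simp: f_def) (simp add: frac_def)
  have r: "\<rho>' * (1 - f) = \<rho>" "0 \<le> \<rho>'"
    using f assms(2) by (auto simp: \<rho>'_def f_def[symmetric])
  have "(a - \<rho>' *\<^sub>R g) \<bullet> z \<le> of_int \<lfloor>\<alpha>\<rfloor> + \<rho>' * g0"
  proof (rule split_closure_le[OF assms(1) _ _ z])
    show "(of_int \<lfloor>\<alpha>\<rfloor>::real) \<in> \<int>" by simp
    fix z assume zC: "z \<in> C" and "(a - \<rho>' *\<^sub>R g) \<bullet> z > of_int \<lfloor>\<alpha>\<rfloor> + \<rho>' * g0"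
    define G where "G = g \<bullet> z + g0"
    have G: "0 \<le> G" using g[OF zC] by (simp add: G_def)
    have gt: "a \<bullet> z > of_int \<lfloor>\<alpha>\<rfloor> + \<rho>' * G"
      using \<open>_ > of_int \<lfloor>\<alpha>\<rfloor> + \<rho>' * g0\<close> by (simp add: G_def algebra_simps inner_diff_left)
    have up: "a \<bullet> z \<le> of_int \<lfloor>\<alpha>\<rfloor> + f + \<rho>' * (1 - f) * G"
      using le[OF zC] f r(1) by (simp add: G_def)
    \<comment> \<open>As functions of the error \<open>G\<close>, the bounds \<open>up\<close> and
      \<open>gt\<close> meet where \<open>\<rho>' * G = 1\<close>, at the value
      \<open>\<lfloor>\<alpha>\<rfloor> + 1\<close>. From there on they contradict each other;
      before that point \<open>up\<close> alone gives the claim.\<close>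
    have "a \<bullet> z < of_int \<lfloor>\<alpha>\<rfloor> + 1"
    proof (rule ccontr)
      assume "\<not> a \<bullet> z < of_int \<lfloor>\<alpha>\<rfloor> + 1"
      then have "(1 - f) * 1 \<le> (1 - f) * (\<rho>' * G)" using up by (simp add: algebra_simps)
      then have "1 \<le> \<rho>' * G" using f by (subst (asm) mult_le_cancel_left_pos) auto
      then have "f * 1 \<le> f * (\<rho>' * G)" using f by (intro mult_left_mono) auto
      then show False using up gt by (simp add: algebra_simps)
    qed
    moreover have "of_int \<lfloor>\<alpha>\<rfloor> < a \<bullet> z" using gt r(2) G by (smt (verit) mult_nonneg_nonneg)
    ultimately show "of_int \<lfloor>\<alpha>\<rfloor> < a \<bullet> z \<and> a \<bullet> z < of_int \<lfloor>\<alpha>\<rfloor> + 1" by simp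
  qed
  then show ?thesis
    unfolding \<rho>'_def[symmetric] by (simp add: algebra_simps inner_diff_left)
qed

text \<open>The error is an abstract affine function because it will be the slack
  \<open>\<mu> * u - s\<close>, which changes from round to round; \<open>R\<close> bounds the
  violation of the system relative to it.\<close>

definition small_error ::
  "((real^'n) \<times> real) set \<Rightarrow> real \<Rightarrow> (real^'n) set \<Rightarrow> real^'n \<Rightarrow> real \<Rightarrow> bool" where
  "small_error B R C g g0 \<longleftrightarrow> (\<forall>z\<in>C. 0 \<le> g \<bullet> z + g0 \<and>
     (\<forall>(b, \<beta>)\<in>B. b \<bullet> z \<le> \<beta> + R * (g \<bullet> z + g0)))"

text \<open>The constants \<open>k\<close> and \<open>\<rho>\<close> depend neither on the set \<open>C\<close> nor on the error term;
this uniformity makes the descent in the main theorem finite.\<close>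

lemma der_split_iter:
  assumes "der I B a \<alpha>" "0 \<le> R"
  shows "\<exists>k \<rho>. 0 \<le> \<rho> \<and> (\<forall>C g g0. small_error B R C g g0 \<longrightarrow>
     (\<forall>z\<in>split_iter I k C. a \<bullet> z \<le> \<alpha> + \<rho> * (g \<bullet> z + g0)))"
  using assms(1)
proof induction
  case (base a \<beta>)
  then show ?case
    using assms(2) by (intro exI[of _ 0] exI[of _ R]) (auto simp: small_error_def)
next
  case (zero \<beta>)
  then show ?case
    by (intro exI[of _ 0]) auto
next
  case (add a \<alpha> b \<beta>)
  obtain k \<rho> where 1: "0 \<le> \<rho>" "\<forall>C g g0. small_error B R C g g0 \<longrightarrow>
      (\<forall>z\<in>split_iter I k C. a \<bullet> z \<le> \<alpha> + \<rho> * (g \<bullet> z + g0))"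
    using add.IH(1) by blast
  obtain k' \<rho>' where 2: "0 \<le> \<rho>'" "\<forall>C g g0. small_error B R C g g0 \<longrightarrow>
      (\<forall>z\<in>split_iter I k' C. b \<bullet> z \<le> \<beta> + \<rho>' * (g \<bullet> z + g0))"
    using add.IH(2) by blast
  show ?case
  proof (intro exI[of _ "max k k'"] exI[of _ "\<rho> + \<rho>'"] conjI allI impI ballI)
    fix C :: "(real^'a) set" and g g0 z
    assume C: "small_error B R C g g0" and z: "z \<in> split_iter I (max k k') C"
    have "z \<in> split_iter I k C" "z \<in> split_iter I k' C"
      using z split_iter_antimono[of k "max k k'" I C] split_iter_antimono[of k' "max k k'" I C]
      by auto
    then have "a \<bullet> z \<le> \<alpha> + \<rho> * (g \<bullet> z + g0)" "b \<bullet> z \<le> \<beta> + \<rho>' * (g \<bullet> z + g0)"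
      using 1(2) 2(2) C by blast+
    then show "(a + b) \<bullet> z \<le> \<alpha> + \<beta> + (\<rho> + \<rho>') * (g \<bullet> z + g0)"
      by (simp add: inner_add_left distrib_right)
  qed (use 1(1) 2(1) in simp)
next
  case (scale c a \<alpha>)
  obtain k \<rho> where 1: "0 \<le> \<rho>" "\<forall>C g g0. small_error B R C g g0 \<longrightarrow>
      (\<forall>z\<in>split_iter I k C. a \<bullet> z \<le> \<alpha> + \<rho> * (g \<bullet> z + g0))"
    using scale.IH by blast
  show ?case
  proof (intro exI[of _ k] exI[of _ "c * \<rho>"] conjI allI impI ballI)
    fix C :: "(real^'a) set" and g g0 z
    assume "small_error B R C g g0" and "z \<in> split_iter I k C"
    then have "a \<bullet> z \<le> \<alpha> + \<rho> * (g \<bullet> z + g0)"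
      using 1(2) by blast
    from mult_left_mono[OF this scale(1)]
    show "(c *\<^sub>R a) \<bullet> z \<le> c * \<alpha> + c * \<rho> * (g \<bullet> z + g0)"
      by (simp add: algebra_simps)
  qed (use 1(1) scale(1) in simp)
next
  case (round a \<alpha>)
  obtain k \<rho> where 1: "0 \<le> \<rho>" "\<forall>C g g0. small_error B R C g g0 \<longrightarrow>
      (\<forall>z\<in>split_iter I k C. a \<bullet> z \<le> \<alpha> + \<rho> * (g \<bullet> z + g0))"
    using round.IH by blast
  show ?case
  proof (intro exI[of _ "Suc k"] exI[of _ "\<rho> / (1 - frac \<alpha>)"] conjI allI impI ballI)
    fix C :: "(real^'a) set" and g g0 z
    assume C: "small_error B R C g g0" and z: "z \<in> split_iter I (Suc k) C"
    show "a \<bullet> z \<le> of_int \<lfloor>\<alpha>\<rfloor> + \<rho> / (1 - frac \<alpha>) * (g \<bullet> z + g0)"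
    proof (rule round_with_error[OF round(1) 1(1)])
      show "z \<in> split_closure I (split_iter I k C)"
        using z by (simp add: split_iter_Suc)
    next
      fix x assume x: "x \<in> split_iter I k C"
      then show "0 \<le> g \<bullet> x + g0"
        using C split_iter_subset[of I k C] by (auto simp: small_error_def)
      show "a \<bullet> x \<le> \<alpha> + \<rho> * (g \<bullet> x + g0)"
        using 1(2) C x by blast
    qed
  next
    show "0 \<le> \<rho> / (1 - frac \<alpha>)" using 1(1) frac_lt_1[of \<alpha>] by simp
  qed
qed

text \<open>Here \<open>\<rho>\<close> can be kept integral, so adding a multiple of the integral
inequality \<open>a \<bullet> z \<le> t\<close> commutes with rounding.\<close>

lemma der_lift_face:
  assumes "der I (insert (a, t) (insert (- a, - t) B)) c \<beta>"
    and a: "int_form I a" "t \<in> \<int>" "der I B a t"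
  shows "\<exists>\<rho>::nat. der I B (c + real \<rho> *\<^sub>R a) (\<beta> + real \<rho> * t)"
  using assms(1)
proof induction
  case (base b \<beta>)
  then consider "b = a" "\<beta> = t" | "b = - a" "\<beta> = - t" | "(b, \<beta>) \<in> B" by auto
  then show ?case
  proof cases
    case 1
    then show ?thesis using a by (auto intro!: exI[of _ 0])
  next
    case 2
    then show ?thesis by (intro exI[of _ 1]) (auto intro: der.zero)
  next
    case 3
    then show ?thesis by (auto intro!: exI[of _ 0] der.base)
  qed
next
  case (zero \<beta>)
  then show ?case by (intro exI[of _ 0]) (auto intro: der.zero)
next
  case (add b \<alpha> c \<beta>)
  then obtain \<rho> \<rho>' :: nat where
    "der I B (b + real \<rho> *\<^sub>R a) (\<alpha> + real \<rho> * t)" "der I B (c + real \<rho>' *\<^sub>R a) (\<beta> + real \<rho>' * t)"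
    by blast
  from der.add[OF this] show ?case
    by (intro exI[of _ "\<rho> + \<rho>'"]) (simp add: algebra_simps)
next
  case (scale \<kappa> b \<alpha>)
  then obtain \<rho> :: nat where \<rho>: "der I B (b + real \<rho> *\<^sub>R a) (\<alpha> + real \<rho> * t)" by blast
  \<comment> \<open>Scaling turns the multiplier into \<open>\<kappa> * \<rho>\<close>; rounding it
    up to an integer costs a nonnegative multiple of \<open>a \<bullet> z \<le> t\<close>.\<close>
  define m where "m = nat \<lceil>\<kappa> * \<rho>\<rceil>"
  have m: "0 \<le> real m - \<kappa> * \<rho>" unfolding m_def by linarith
  show ?case
    using der.add[OF der.scale[OF scale(1) \<rho>] der.scale[OF m a(3)]]
    by (intro exI[of _ m]) (simp add: algebra_simps)
next
  case (round b \<alpha>)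
  then obtain \<rho> :: nat where \<rho>: "der I B (b + real \<rho> *\<^sub>R a) (\<alpha> + real \<rho> * t)" by blast
  have "int_form I (b + real \<rho> *\<^sub>R a)"
    using round(1) a(1) by (auto simp: int_form_def)
  from der.round[OF this \<rho>]
  have "der I B (b + real \<rho> *\<^sub>R a) (of_int \<lfloor>\<alpha> + real \<rho> * t\<rfloor>)" .
  moreover obtain t' where "t = of_int t'" using a(2) by (auto elim: Ints_cases)
  then have "\<lfloor>\<alpha> + real \<rho> * t\<rfloor> = \<lfloor>\<alpha>\<rfloor> + int \<rho> * t'"
    using floor_add_int[of \<alpha> "int \<rho> * t'"] by simp
  ultimately show ?case
    using \<open>t = _\<close> by (intro exI[of _ \<rho>]) simp
qed

text \<open>Lifting the refutation from the face \<open>a \<bullet> z = t\<close> gives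
  \<open>\<rho> * (a \<bullet> z) \<le> \<rho> * t - 1\<close>; dividing by \<open>\<rho>\<close>
  and rounding lowers the bound by one. For \<open>\<rho> = 0\<close> the system \<open>B\<close> is
  itself refuted.\<close>

lemma der_decrease:
  fixes t :: int
  assumes "int_form I a" "der I B a (of_int t)"
    and "der I (insert (a, of_int t) (insert (- a, - of_int t) B)) 0 (-1)"
  shows "der I B a (of_int (t - 1))"
proof -
  obtain \<rho> :: nat where \<rho>: "der I B (0 + real \<rho> *\<^sub>R a) (-1 + real \<rho> * of_int t)"
    using der_lift_face[OF assms(3,1) _ assms(2)] by auto
  show ?thesis
  proof (cases "\<rho> = 0")
    case True
    then have "der I B 0 (-1)" using \<rho> by simp
    from der.add[OF assms(2) this] show ?thesis by simp
  next
    case False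
    have "der I B ((1 / \<rho>) *\<^sub>R (0 + real \<rho> *\<^sub>R a)) ((1 / \<rho>) * (-1 + real \<rho> * of_int t))"
      by (rule der.scale[OF _ \<rho>]) simp
    then have "der I B a (of_int t - 1 / \<rho>)"
      using False by (simp add: field_simps)
    from der.round[OF assms(1) this] have "der I B a (of_int \<lfloor>of_int t - 1 / real \<rho>\<rfloor>)" .
    moreover have "\<lfloor>of_int t - 1 / real \<rho>\<rfloor> \<le> t - 1"
      using False floor_less_iff[of "of_int t - 1 / real \<rho>" t] by simp
    ultimately show ?thesis by (meson der_weaken of_int_le_iff)
  qed
qed

text \<open>From an integral bound obtained out of \<open>\<alpha>\<close>, the right-hand side
  sinks past one refuted slice after another until it reaches \<open>t0\<close>.\<close>

lemma der_slices:
  fixes t0 :: int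
  assumes "int_form I a" "der I B a \<alpha>"
    and "\<And>t::int. t0 < t \<Longrightarrow> der I (insert (a, of_int t) (insert (- a, - of_int t) B)) 0 (-1)"
  shows "der I B a (of_int t0)"
proof -
  have "der I B a (of_int (t0 + int n)) \<Longrightarrow> der I B a (of_int t0)" for n
  proof (induction n)
    case (Suc n)
    have "der I B a (of_int (t0 + int (Suc n) - 1))"
      by (rule der_decrease[OF assms(1) Suc.prems assms(3)]) simp
    then show ?case using Suc.IH by simp
  qed simp
  moreover have "der I B a (of_int (t0 + int (nat (\<lfloor>\<alpha>\<rfloor> - t0))))"
    by (rule der_weaken[OF der.round[OF assms(1,2)]]) linarith
  ultimately show ?thesis by blast
qed

lemma der_slices_infeasible:
  assumes "int_form I a" "der I B a \<alpha>" "der I B (- a) \<beta>"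
    and "\<And>t::int. der I (insert (a, of_int t) (insert (- a, - of_int t) B)) 0 (-1)"
  shows "der I B 0 (-1)"
proof -
  \<comment> \<open>The target lies one below \<open>- \<lceil>\<beta>\<rceil>\<close>, so that
    adding \<open>- a \<bullet> z \<le> \<beta>\<close> leaves a right-hand side of at most
    -1.\<close>
  have "der I B a (of_int (- \<lceil>\<beta>\<rceil> - 1))"
    using der_slices[OF assms(1,2,4)] .
  from der.add[OF this assms(3)] have "der I B 0 (of_int (- \<lceil>\<beta>\<rceil> - 1) + \<beta>)" by simp
  then show ?thesis by (rule der_weaken) linarith
qed

section \<open>Completeness of the derivations for systems without integral solutions\<close>

lemma rat_vec_int_multiple:
  fixes a :: "real^'n"
  assumes "rat_vec a"
  obtains N :: nat where "0 < N" "\<And>i. real N * a $ i \<in> \<int>"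
proof -
  have "\<exists>q::nat. 0 < q \<and> real q * a $ i \<in> \<int>" for i
  proof -
    have "a $ i \<in> \<rat>" using assms by (simp add: rat_vec_def)
    then obtain m :: int and n :: nat where "n \<noteq> 0" "a $ i = of_int m / real n"
      by (auto simp: Rats_eq_int_div_nat)
    then show ?thesis by (intro exI[of _ n]) auto
  qed
  then obtain q :: "'n \<Rightarrow> nat" where q: "\<And>i. 0 < q i" "\<And>i. real (q i) * a $ i \<in> \<int>" by metis
  show ?thesis
  proof
    show "0 < (\<Prod>i\<in>UNIV. q i)" using q by simp
    fix i
    have "real (\<Prod>i\<in>UNIV. q i) * a $ i = real (\<Prod>i\<in>UNIV - {i}. q i) * (real (q i) * a $ i)"
      by (subst prod.remove[of _ i]) auto
    also have "\<dots> \<in> \<int>" by (rule Ints_mult[OF Ints_of_nat q(2)])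
    finally show "real (\<Prod>i\<in>UNIV. q i) * a $ i \<in> \<int>" .
  qed
qed

text \<open>Far out in direction \<open>- r\<close>, every row with nonzero normal has slack at
  least the sum of the \<open>\<bar>a $ i\<bar>\<close>, which bounds the effect of rounding each
  coordinate to an integer.\<close>

lemma strict_recession_imp_integral_solution:
  fixes B :: "((real^'n) \<times> real) set"
  assumes "finite B" "0 < b"
    and "\<And>a \<beta>. (a, \<beta>) \<in> B \<Longrightarrow> a = 0 \<Longrightarrow> 0 \<le> \<beta>"
    and r: "\<And>a \<beta>. (a, \<beta>) \<in> B \<Longrightarrow> a \<noteq> 0 \<Longrightarrow> b < a \<bullet> r"
  shows "\<exists>x\<in>sols B. \<forall>i. x $ i \<in> \<int>"
proof -
  have "eventually (\<lambda>T. T \<ge> 0 \<and> (\<forall>p\<in>B. (\<Sum>i\<in>UNIV. \<bar>fst p $ i\<bar>) - snd p \<le> T * b)) at_top"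
  proof (intro eventually_conj eventually_ge_at_top eventually_ball_finite[OF assms(1)] ballI)
    fix p :: "(real^'n) \<times> real"
    have "filterlim (\<lambda>T. T * b) at_top at_top"
      using assms(2) by (intro filterlim_at_top_mult_tendsto_pos[OF tendsto_const _ filterlim_ident])
    then show "eventually (\<lambda>T. (\<Sum>i\<in>UNIV. \<bar>fst p $ i\<bar>) - snd p \<le> T * b) at_top"
      by (simp add: filterlim_at_top)
  qed
  from eventually_happens'[OF trivial_limit_at_top_linorder this]
  obtain T where T: "0 \<le> T" "\<forall>p\<in>B. (\<Sum>i\<in>UNIV. \<bar>fst p $ i\<bar>) - snd p \<le> T * b"
    by blast
  define x :: "real^'n" where "x = (\<chi> i. of_int \<lfloor>- T * r $ i\<rfloor>)"
  have "x \<in> sols B"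
  proof (rule solsI)
    fix a \<beta> assume ab: "(a, \<beta>) \<in> B"
    show "a \<bullet> x \<le> \<beta>"
    proof (cases "a = 0")
      case False
      have "a $ i * x $ i \<le> - T * (a $ i * r $ i) + \<bar>a $ i\<bar>" for i
      proof -
        have "\<bar>x $ i - - T * r $ i\<bar> \<le> 1" unfolding x_def by (simp, linarith)
        then have "\<bar>a $ i\<bar> * \<bar>x $ i - - T * r $ i\<bar> \<le> \<bar>a $ i\<bar> * 1" by (intro mult_left_mono) auto
        then have "a $ i * (x $ i - - T * r $ i) \<le> \<bar>a $ i\<bar>"
          using abs_ge_self[of "a $ i * (x $ i - - T * r $ i)"] unfolding abs_mult by linarith
        then show ?thesis by (simp add: algebra_simps)
      qed
      then have "a \<bullet> x \<le> (\<Sum>i\<in>UNIV. - T * (a $ i * r $ i) + \<bar>a $ i\<bar>)"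
        unfolding inner_vec_def by (intro sum_mono) simp
      also have "\<dots> = - T * (a \<bullet> r) + (\<Sum>i\<in>UNIV. \<bar>a $ i\<bar>)"
        by (simp add: sum_subtractf inner_vec_def sum_distrib_left sum_negf)
      also have "\<dots> \<le> \<beta>"
        using mult_left_mono[OF less_imp_le[OF r[OF ab False]] T(1)] bspec[OF T(2) ab] by simp
      finally show ?thesis .
    qed (use assms(3) ab in auto)
  qed
  moreover have "x $ i \<in> \<int>" for i by (simp add: x_def)
  ultimately show ?thesis by blast
qed

section \<open>Unimodular changes of coordinates\<close>

lemma der_linear_image:
  assumes "der J B a \<alpha>" "linear T" "\<And>a. int_form J a \<Longrightarrow> int_form J (T a)"
  shows "der J ((\<lambda>(a, \<beta>). (T a, \<beta>)) ` B) (T a) \<alpha>"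
  using assms(1)
proof induction
  case (base a \<beta>)
  then show ?case by (intro der.base) force
next
  case (round a \<alpha>)
  then show ?case using assms(3) by (intro der.round) auto
qed (use assms(2) in \<open>auto simp: linear_0 linear_add linear_cmul intro: der.intros\<close>)

text \<open>On forms this is an elementary step of the Euclidean algorithm; on points its transpose
  \<open>shear j i\<close> acts. For \<open>i \<noteq> j\<close> and integral
  \<open>\<sigma>\<close> it is unimodular.\<close>

definition shear :: "'n \<Rightarrow> 'n \<Rightarrow> real \<Rightarrow> real^'n \<Rightarrow> real^'n" where
  "shear i j \<sigma> a = a - (\<sigma> * a $ j) *\<^sub>R axis i 1"

lemma shear_nth: "shear i j \<sigma> a $ k = (if k = i then a $ i - \<sigma> * a $ j else a $ k)"
  by (auto simp: shear_def axis_def)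

lemma linear_shear: "linear (shear i j \<sigma>)"
  by (rule linearI) (auto simp: vec_eq_iff shear_nth algebra_simps)

lemma inner_shear: "shear i j \<sigma> a \<bullet> x = a \<bullet> shear j i \<sigma> x"
  by (simp add: shear_def inner_diff_left inner_diff_right inner_axis inner_axis')

lemma shear_inverse: "i \<noteq> j \<Longrightarrow> shear i j (- \<sigma>) (shear i j \<sigma> a) = a"
  by (auto simp: vec_eq_iff shear_nth)

lemma int_form_shear:
  "int_form J a \<Longrightarrow> i \<in> J \<Longrightarrow> j \<in> J \<Longrightarrow> \<sigma> \<in> \<int> \<Longrightarrow> int_form J (shear i j \<sigma> a)"
  by (auto simp: int_form_def shear_nth)

text \<open>Only the normals are rational: right-hand sides may be real, since the value
  \<open>\<gamma>\<close> will occur among them. The support condition says that all continuous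
  variables have been eliminated.\<close>

definition rat_system :: "'n set \<Rightarrow> ((real^'n) \<times> real) set \<Rightarrow> bool" where
  "rat_system J B \<longleftrightarrow> finite B \<and> (\<forall>(a, \<beta>)\<in>B. rat_vec a \<and> (\<forall>i. i \<notin> J \<longrightarrow> a $ i = 0))"

text \<open>Substituting \<open>t\<close> for coordinate \<open>j\<close> gives a system over
  \<open>J - {j}\<close> that still has no integral solution, so the induction hypothesis refutes
  every slice; the two bounds then leave the coordinate no value.\<close>

lemma refute_bounded_coordinate:
  assumes IH: "\<And>B. rat_system (J - {j}) B \<Longrightarrow> \<forall>x\<in>sols B. \<not> int_on (J - {j}) x
       \<Longrightarrow> der (J - {j}) B 0 (-1)"
    and B: "rat_system J B" "\<forall>x\<in>sols B. \<not> int_on J x" and j: "j \<in> J"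
    and bdd: "der J B (axis j 1) \<alpha>" "der J B (- axis j 1) \<beta>"
  shows "der J B 0 (-1)"
proof (rule der_slices_infeasible[OF _ bdd])
  show "int_form J (axis j 1)" using j by (auto simp: int_form_def axis_def)
  fix t :: int
  define Bt :: "((real^'a) \<times> real) set" where
    "Bt = (\<lambda>(a, \<beta>). (a - a $ j *\<^sub>R axis j 1, \<beta> - a $ j * of_int t)) ` B"
  let ?B = "insert (axis j 1, of_int t) (insert (- axis j 1, - of_int t) B)"
  have "der (J - {j}) Bt 0 (-1)"
  proof (rule IH)
    show "rat_system (J - {j}) Bt"
      using B(1) unfolding rat_system_def Bt_def by (auto simp: rat_vec_def axis_def) blast+
    show "\<forall>x\<in>sols Bt. \<not> int_on (J - {j}) x"
    proof (intro ballI notI)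
      fix x assume x: "x \<in> sols Bt" "int_on (J - {j}) x"
      define x' where "x' = x + (of_int t - x $ j) *\<^sub>R axis j 1"
      have "x' \<in> sols B"
      proof (rule solsI)
        fix a \<beta> assume "(a, \<beta>) \<in> B"
        then have "(a - a $ j *\<^sub>R axis j 1, \<beta> - a $ j * of_int t) \<in> Bt"
          unfolding Bt_def by force
        from solsD[OF x(1) this] show "a \<bullet> x' \<le> \<beta>"
          by (simp add: x'_def inner_add_right inner_diff_left inner_axis inner_axis' algebra_simps)
      qed
      moreover have "int_on J x'"
        using x(2) by (auto simp: int_on_def x'_def axis_def)
      ultimately show False using B(2) by blast
    qed
  qed
  then show "der J ?B 0 (-1)"
  proof (rule der_trans)
    fix b \<beta>' assume "(b, \<beta>') \<in> Bt"
    then obtain a \<beta> where ab: "(a, \<beta>) \<in> B" "b = a - a $ j *\<^sub>R axis j 1" "\<beta>' = \<beta> - a $ j * of_int t"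
      by (auto simp: Bt_def)
    have 1: "der J ?B a \<beta>" "der J ?B (axis j 1) (of_int t)" "der J ?B (- axis j 1) (- of_int t)"
      using ab(1) by (auto intro: der.base)
    show "der J ?B b \<beta>'"
    \<comment> \<open>A substituted row is the original row plus a multiple of
      \<open>x $ j = t\<close>; the sign of \<open>a $ j\<close> decides which of the two
      inequalities of the slice is added.\<close>
    proof (cases "a $ j \<le> 0")
      case True
      then show ?thesis
        using der.add[OF 1(1) der.scale[OF _ 1(2), of "- a $ j"]] ab by simp
    next
      case False
      then show ?thesis
        using der.add[OF 1(1) der.scale[OF _ 1(3), of "a $ j"]] ab by simp
    qed
  qed simp
qed

text \<open>Unimodular shears run the Euclidean algorithm on the coefficients of a bounded
integral form until the form is a multiple of a single coordinate.\<close>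

lemma refute_bounded_form:
  assumes IH: "\<And>j B. j \<in> J \<Longrightarrow> rat_system (J - {j}) B \<Longrightarrow> \<forall>x\<in>sols B. \<not> int_on (J - {j}) x
       \<Longrightarrow> der (J - {j}) B 0 (-1)"
    and "rat_system J B" "\<forall>x\<in>sols B. \<not> int_on J x"
    and "int_form J n" "n \<noteq> 0" "der J B n \<alpha>" "der J B (- n) \<beta>"
  shows "der J B 0 (-1)"
  using assms(2-)
proof (induction "nat \<lfloor>\<Sum>i\<in>UNIV. \<bar>n $ i\<bar>\<rfloor>" arbitrary: B n rule: less_induct)
  case less
  have inJ: "i \<in> J" "n $ i \<in> \<int>" if "n $ i \<noteq> 0" for i
    using less.prems(3) that unfolding int_form_def by metis+
  show ?case
  proof (cases "\<exists>i j. i \<noteq> j \<and> n $ j \<noteq> 0 \<and> \<bar>n $ j\<bar> \<le> \<bar>n $ i\<bar>")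
    case True
    then obtain i j where ij: "i \<noteq> j" "n $ j \<noteq> 0" "\<bar>n $ j\<bar> \<le> \<bar>n $ i\<bar>" by blast
    then have ni: "n $ i \<noteq> 0" by auto
    \<comment> \<open>With this sign the shear replaces \<open>\<bar>n $ i\<bar>\<close> by
      \<open>\<bar>n $ i\<bar> - \<bar>n $ j\<bar>\<close>. As
      \<open>\<bar>n $ j\<bar> \<ge> 1\<close>, the induction measure drops.\<close>
    define \<sigma> where "\<sigma> = sgn (n $ i) * sgn (n $ j)"
    have \<sigma>: "\<sigma> \<in> \<int>" "- \<sigma> \<in> \<int>" "\<sigma> \<in> \<rat>" by (auto simp: \<sigma>_def sgn_if)
    define T where "T = shear i j \<sigma>"
    define TB where "TB = (\<lambda>(a, \<beta>). (T a, \<beta>)) ` B"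
    have J: "i \<in> J" "j \<in> J" using inJ ij ni by auto
    have Tint: "int_form J (T a)" if "int_form J a" for a
      unfolding T_def using int_form_shear that J \<sigma> by blast
    have abs_i: "\<bar>T n $ i\<bar> = \<bar>n $ i\<bar> - \<bar>n $ j\<bar>"
      using ij by (auto simp: T_def shear_nth \<sigma>_def sgn_if)
    have sum_split: "(\<Sum>k\<in>UNIV. \<bar>m $ k\<bar>) = \<bar>m $ i\<bar> + (\<Sum>k\<in>UNIV - {i}. \<bar>m $ k\<bar>)" for m :: "real^'a"
      by (subst sum.remove[of _ i]) auto
    have "(\<Sum>k\<in>UNIV - {i}. \<bar>T n $ k\<bar>) = (\<Sum>k\<in>UNIV - {i}. \<bar>n $ k\<bar>)"
      by (intro sum.cong) (auto simp: T_def shear_nth)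
    then have sum_eq: "(\<Sum>k\<in>UNIV. \<bar>T n $ k\<bar>) = (\<Sum>k\<in>UNIV. \<bar>n $ k\<bar>) - \<bar>n $ j\<bar>"
      using sum_split[of "T n"] sum_split[of n] abs_i by simp
    have "\<bar>n $ j\<bar> \<ge> 1"
      using inJ(2)[OF ij(2)] ij(2) by (auto elim!: Ints_cases)
    moreover have "0 \<le> (\<Sum>k\<in>UNIV. \<bar>T n $ k\<bar>)" by (simp add: sum_nonneg)
    ultimately have decr: "nat \<lfloor>\<Sum>k\<in>UNIV. \<bar>T n $ k\<bar>\<rfloor> < nat \<lfloor>\<Sum>k\<in>UNIV. \<bar>n $ k\<bar>\<rfloor>"
      using sum_eq by linarith
    have derT: "der J TB (T a) \<alpha>" if "der J B a \<alpha>" for a \<alpha>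
      unfolding TB_def by (rule der_linear_image[OF that]) (auto simp: T_def linear_shear Tint[unfolded T_def])
    have "der J TB 0 (-1)"
    proof (rule less.hyps[OF decr])
      show "rat_system J TB"
        using less.prems(1) J \<sigma>(3) unfolding rat_system_def TB_def
        by (fastforce simp: rat_vec_def T_def shear_nth)
      show "\<forall>x\<in>sols TB. \<not> int_on J x"
      proof (intro ballI notI)
        fix x assume x: "x \<in> sols TB" "int_on J x"
        have "shear j i \<sigma> x \<in> sols B"
        proof (rule solsI)
          fix a \<beta> assume "(a, \<beta>) \<in> B"
          then have "(T a, \<beta>) \<in> TB" unfolding TB_def by force
          from solsD[OF x(1) this] show "a \<bullet> shear j i \<sigma> x \<le> \<beta>"
            by (simp add: T_def inner_shear)
        qed
        moreover have "int_on J (shear j i \<sigma> x)"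
          using x(2) \<sigma> J by (auto simp: int_on_def shear_nth)
        ultimately show False using less.prems(2) by blast
      qed
      show "int_form J (T n)" using Tint less.prems(3) by blast
      show "T n \<noteq> 0"
      proof
        assume "T n = 0"
        then have "n = shear i j (- \<sigma>) 0"
          using shear_inverse[OF ij(1), of \<sigma> n] by (simp add: T_def)
        then show False using less.prems(4) by (simp add: linear_0[OF linear_shear])
      qed
      show "der J TB (T n) \<alpha>" using derT less.prems(5) by blast
      show "der J TB (- T n) \<beta>"
        using derT[OF less.prems(6)] by (simp add: T_def linear_neg[OF linear_shear])
    qed
    \<comment> \<open>The inverse shear carries the refutation back: it restores \<open>B\<close>
      and fixes the zero form.\<close>
    then have "der J ((\<lambda>(a, \<beta>). (shear i j (- \<sigma>) a, \<beta>)) ` TB) (shear i j (- \<sigma>) 0) (-1)"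
      by (rule der_linear_image) (use J \<sigma> in \<open>auto simp: linear_shear int_form_shear\<close>)
    moreover have "(\<lambda>(a, \<beta>). (shear i j (- \<sigma>) a, \<beta>)) ` TB = B"
      unfolding TB_def T_def image_image by (simp add: case_prod_beta shear_inverse[OF ij(1)])
    ultimately show ?thesis by (simp add: linear_0[OF linear_shear])
  next
    case False
    obtain j where j: "n $ j \<noteq> 0" using less.prems(4) by (auto simp: vec_eq_iff)
    \<comment> \<open>Of two nonzero entries one dominates the other in absolute value, so without
      such a pair only the entry \<open>j\<close> is nonzero.\<close>
    have "n $ i = 0" if "i \<noteq> j" for i
      using False j that by (metis linear)
    then have n: "n = (n $ j) *\<^sub>R axis j 1"
      by (auto simp: vec_eq_iff axis_def)
    define m where "m = n $ j"
    have nm: "n = m *\<^sub>R axis j 1" "m \<noteq> 0" using n j by (simp_all add: m_def)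
    have d: "der J B (c *\<^sub>R n) (c * \<alpha>)" "der J B (c *\<^sub>R (- n)) (c * \<beta>)" if "0 \<le> c" for c
      using that less.prems(5,6) by (auto intro: der.scale simp del: scaleR_minus_right)
    have "\<exists>\<alpha>' \<beta>'. der J B (axis j 1) \<alpha>' \<and> der J B (- axis j 1) \<beta>'"
    proof (cases "m > 0")
      case True
      then show ?thesis using d[of "1 / m"] nm by auto
    next
      case False
      then show ?thesis using d[of "- 1 / m"] nm by auto
    qed
    then obtain \<alpha>' \<beta>' where "der J B (axis j 1) \<alpha>'" "der J B (- axis j 1) \<beta>'" by blast
    with refute_bounded_coordinate[OF IH less.prems(1,2)] inJ(1)[OF j] show ?thesis by blast
  qed
qed

text \<open>Apart from an outright contradictory row there are two cases. If the convex hull of the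
  nonzero normals misses 0, a separating hyperplane yields a direction of strict recession and hence
  an integral solution. Otherwise a convex combination of them vanishes, and a normal with positive
  weight is bounded on both sides; an integral multiple of it goes to
  \<open>refute_bounded_form\<close>, with induction on the number of integer variables.\<close>

theorem refute_pure:
  assumes "finite J" "rat_system J B" "\<forall>x\<in>sols B. \<not> int_on J x"
  shows "der J B 0 (-1)"
  using assms
proof (induction "card J" arbitrary: J B rule: less_induct)
  case less
  have fin: "finite B" using less.prems(2) by (simp add: rat_system_def)
  define A where "A = {a. a \<noteq> 0 \<and> (\<exists>\<beta>. (a, \<beta>) \<in> B)}"
  have "A \<subseteq> fst ` B" by (force simp: A_def)
  then have finA: "finite A" using fin finite_subset by blast
  have derA: "\<exists>\<beta>. der J B a \<beta>" if "a \<in> A" for a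
    using that by (auto simp: A_def intro: der.base)
  consider (triv) \<beta> where "(0, \<beta>) \<in> B" "\<beta> < 0"
    | (ray) "0 \<notin> convex hull A" "\<And>\<beta>. (0, \<beta>) \<in> B \<Longrightarrow> 0 \<le> \<beta>"
    | (bdd) "0 \<in> convex hull A"
    by (meson not_le)
  then show ?case
  proof cases
    case triv
    have "der J B ((- 1 / \<beta>) *\<^sub>R 0) ((- 1 / \<beta>) * \<beta>)"
      using triv by (intro der.scale der.base) auto
    then show ?thesis using triv by simp
  next
    case ray
    have "closed (convex hull A)"
      using finA by (simp add: compact_imp_closed finite_imp_compact_convex_hull)
    then obtain r b where "0 < b" and r: "\<And>a. a \<in> convex hull A \<Longrightarrow> b < r \<bullet> a"
      using separating_hyperplane_closed_0[OF convex_convex_hull _ ray(1)] by blast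
    have "\<exists>x\<in>sols B. \<forall>i. x $ i \<in> \<int>"
    proof (rule strict_recession_imp_integral_solution[OF fin \<open>0 < b\<close>])
      show "b < a \<bullet> r" if "(a, \<beta>) \<in> B" "a \<noteq> 0" for a \<beta>
        using r[OF hull_inc[of a A convex]] that by (auto simp: A_def inner_commute)
    qed (use ray(2) in auto)
    then show ?thesis using less.prems(3) by (auto simp: int_on_def)
  next
    case bdd
    then obtain u where u: "\<And>a. a \<in> A \<Longrightarrow> 0 \<le> u a" "sum u A = 1" "(\<Sum>a\<in>A. u a *\<^sub>R a) = 0"
      unfolding convex_hull_finite[OF finA] by auto
    have "\<exists>a\<in>A. u a \<noteq> 0"
      using u(2) by (metis sum.neutral zero_neq_one)
    then obtain a where a: "a \<in> A" "0 < u a"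
      using u(1) by (metis less_eq_real_def)
    have "(\<Sum>b\<in>A. u b *\<^sub>R b) = u a *\<^sub>R a + (\<Sum>b\<in>A - {a}. u b *\<^sub>R b)"
      using finA a by (subst sum.remove[of _ a]) auto
    then have "(\<Sum>b\<in>A - {a}. u b *\<^sub>R b) = - (u a *\<^sub>R a)"
      using u(3) by (simp add: eq_neg_iff_add_eq_0 add.commute)
    moreover obtain \<beta> where "der J B (\<Sum>b\<in>A - {a}. u b *\<^sub>R b) \<beta>"
      using der_sum[of "A - {a}" u J B] finA u(1) derA by auto
    ultimately have neg: "der J B (- (u a *\<^sub>R a)) \<beta>" by simp
    obtain \<alpha> where pos: "der J B a \<alpha>" using derA a(1) by blast
    have arat: "rat_vec a" "\<And>i. i \<notin> J \<Longrightarrow> a $ i = 0" and "a \<noteq> 0"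
      using a(1) less.prems(2) by (auto simp: A_def rat_system_def)
    obtain N :: nat where N: "0 < N" "\<And>i. real N * a $ i \<in> \<int>"
      using rat_vec_int_multiple[OF arat(1)] by blast
    define n where "n = real N *\<^sub>R a"
    show ?thesis
    proof (rule refute_bounded_form[OF _ less.prems(2,3)])
      show "int_form J n" using N arat(2) by (auto simp: int_form_def n_def)
      show "n \<noteq> 0" using N \<open>a \<noteq> 0\<close> by (simp add: n_def)
      show "der J B n (real N * \<alpha>)" unfolding n_def by (intro der.scale pos) simp
      have "der J B ((real N / u a) *\<^sub>R (- (u a *\<^sub>R a))) (real N / u a * \<beta>)"
        using a(2) by (intro der.scale neg) simp
      then show "der J B (- n) (real N / u a * \<beta>)"
        using a(2) by (simp add: n_def)
    next
      fix j B assume "j \<in> J" "rat_system (J - {j}) B" "\<forall>x\<in>sols B. \<not> int_on (J - {j}) x"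
      then show "der (J - {j}) B 0 (- 1)"
        using less.hyps[of "J - {j}" B] less.prems(1) by (meson card_Diff1_less finite_Diff)
    qed
  qed
qed

section \<open>Fourier-Motzkin elimination\<close>

text \<open>Kept apart from rationality of the normals: it is invoked for homogeneous systems, where
  it yields rational rays, while the right-hand sides of other systems may be real.\<close>

definition rat_rhs :: "((real^'n) \<times> real) set \<Rightarrow> bool" where
  "rat_rhs B \<longleftrightarrow> (\<forall>(a, \<beta>)\<in>B. \<beta> \<in> \<rat>)"

lemma rat_vec_add: "rat_vec a \<Longrightarrow> rat_vec b \<Longrightarrow> rat_vec (a + b)"
  by (simp add: rat_vec_def)

lemma rat_vec_diff: "rat_vec a \<Longrightarrow> rat_vec b \<Longrightarrow> rat_vec (a - b)"
  by (simp add: rat_vec_def)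

lemma rat_vec_scaleR: "c \<in> \<rat> \<Longrightarrow> rat_vec a \<Longrightarrow> rat_vec (c *\<^sub>R a)"
  by (simp add: rat_vec_def)

lemma rat_vec_axis: "rat_vec (axis i 1)"
  by (simp add: rat_vec_def axis_def)

lemma Rats_inner: "rat_vec a \<Longrightarrow> rat_vec b \<Longrightarrow> a \<bullet> b \<in> \<rat>"
  unfolding inner_vec_def by (intro Rats_sum) (simp add: rat_vec_def)

lemma der_orthogonal:
  assumes "der I B a \<alpha>" "\<And>b \<beta>. (b, \<beta>) \<in> B \<Longrightarrow> b \<bullet> c = 0"
  shows "a \<bullet> c = 0"
  using assms(1) by induction (auto simp: assms(2) inner_add_left)

text \<open>The separator is picked among the given numbers or 0, so that rational bounds yield a
  rational separator.\<close>

lemma separate_finite_sets: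
  fixes L U :: "real set"
  assumes "finite L" "finite U" "\<And>l u. l \<in> L \<Longrightarrow> u \<in> U \<Longrightarrow> l \<le> u"
  shows "\<exists>\<tau>\<in>insert 0 (L \<union> U). (\<forall>l\<in>L. l \<le> \<tau>) \<and> (\<forall>u\<in>U. \<tau> \<le> u)"
proof (cases "U = {}")
  case True
  show ?thesis
  proof (cases "L = {}")
    case False
    then show ?thesis using True assms(1) by (intro bexI[of _ "Max L"]) auto
  qed (use True in auto)
next
  case False
  then show ?thesis using assms by (intro bexI[of _ "Min U"]) auto
qed

text \<open>On a line \<open>z + \<tau> *\<^sub>R v\<close>, rows with
  \<open>a \<bullet> v > 0\<close> bound \<open>\<tau>\<close> from above and rows with
  \<open>a \<bullet> v < 0\<close> from below. The combined rows say that each lower bound is at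
  most each upper bound, which is what the existence of \<open>\<tau>\<close> requires.\<close>

lemma eliminate_direction:
  fixes B :: "((real^'n) \<times> real) set"
  assumes fin: "finite B" and rat: "\<And>a \<beta>. (a, \<beta>) \<in> B \<Longrightarrow> rat_vec a" and v: "rat_vec v"
  obtains B' where "finite B'"
    and "\<And>a \<beta>. (a, \<beta>) \<in> B' \<Longrightarrow> rat_vec a \<and> der {} B a \<beta> \<and> a \<bullet> v = 0"
    and "rat_rhs B \<Longrightarrow> rat_rhs B'"
    and "\<And>z. z \<in> sols B' \<Longrightarrow>
      \<exists>\<tau>. z + \<tau> *\<^sub>R v \<in> sols B \<and> (rat_rhs B \<longrightarrow> rat_vec z \<longrightarrow> \<tau> \<in> \<rat>)"
proof -
  define Pos where "Pos = {p \<in> B. fst p \<bullet> v > 0}"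
  define Neg where "Neg = {p \<in> B. fst p \<bullet> v < 0}"
  \<comment> \<open>The weights are nonnegative on \<open>Pos \<times> Neg\<close> and cancel the
    component along \<open>v\<close>.\<close>
  define comb :: "((real^'n) \<times> real) \<times> ((real^'n) \<times> real) \<Rightarrow> (real^'n) \<times> real" where
    "comb = (\<lambda>(p, q). ((- (fst q \<bullet> v)) *\<^sub>R fst p + (fst p \<bullet> v) *\<^sub>R fst q,
                       (- (fst q \<bullet> v)) * snd p + (fst p \<bullet> v) * snd q))"
  define B' where "B' = {p \<in> B. fst p \<bullet> v = 0} \<union> comb ` (Pos \<times> Neg)"
  have ratB: "fst p \<bullet> v \<in> \<rat>" "rat_vec (fst p)" if "p \<in> B" for p
    using rat[of "fst p" "snd p"] that v by (auto intro: Rats_inner)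
  have subB: "p \<in> B" if "p \<in> Pos \<or> p \<in> Neg" for p
    using that by (auto simp: Pos_def Neg_def)
  have cases_B': thesis if "x \<in> B'" and "x \<in> B \<Longrightarrow> fst x \<bullet> v = 0 \<Longrightarrow> thesis"
    and "\<And>p q. p \<in> Pos \<Longrightarrow> q \<in> Neg \<Longrightarrow> x = comb (p, q) \<Longrightarrow> thesis" for x thesis
    using that by (auto simp: B'_def)
  have elim: "rat_vec (fst x) \<and> fst x \<bullet> v = 0 \<and> der {} B (fst x) (snd x) \<and> (rat_rhs B \<longrightarrow> snd x \<in> \<rat>)"
    if "x \<in> B'" for x
    using that
  proof (rule cases_B')
    assume "x \<in> B" "fst x \<bullet> v = 0"
    then show ?thesis using ratB(2) by (cases x) (auto intro: der.base simp: rat_rhs_def)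
  next
    fix p q assume pq: "p \<in> Pos" "q \<in> Neg" "x = comb (p, q)"
    then have "p \<in> B" "q \<in> B" "0 \<le> - (fst q \<bullet> v)" "0 \<le> fst p \<bullet> v"
      by (auto simp: Pos_def Neg_def)
    moreover from this have "der {} B (fst p) (snd p)" "der {} B (fst q) (snd q)"
      by (auto intro: der.base)
    ultimately have "der {} B (fst x) (snd x)"
      unfolding pq(3) comb_def by (simp only: prod.case fst_conv snd_conv) (intro der.add der.scale)
    moreover have "rat_rhs B \<Longrightarrow> snd p \<in> \<rat>" "rat_rhs B \<Longrightarrow> snd q \<in> \<rat>"
      using \<open>p \<in> B\<close> \<open>q \<in> B\<close> by (auto simp: rat_rhs_def)
    ultimately show ?thesis
      using ratB[OF \<open>p \<in> B\<close>] ratB[OF \<open>q \<in> B\<close>] unfolding pq(3) comb_def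
      by (auto simp: inner_diff_left inner_add_left intro!: rat_vec_scaleR rat_vec_diff)
  qed
  have rev_sol: "\<exists>\<tau>. z + \<tau> *\<^sub>R v \<in> sols B \<and> (rat_rhs B \<longrightarrow> rat_vec z \<longrightarrow> \<tau> \<in> \<rat>)" if z: "z \<in> sols B'" for z
  proof -
    \<comment> \<open>\<open>f p\<close> is the value of \<open>\<tau>\<close> at which row
      \<open>p\<close> becomes tight.\<close>
    define f where "f = (\<lambda>p. (snd p - fst p \<bullet> z) / (fst p \<bullet> v))"
    have "\<exists>\<tau>\<in>insert 0 (f ` Neg \<union> f ` Pos). (\<forall>l\<in>f ` Neg. l \<le> \<tau>) \<and> (\<forall>u\<in>f ` Pos. \<tau> \<le> u)"
    proof (rule separate_finite_sets)
      fix l u assume "l \<in> f ` Neg" "u \<in> f ` Pos"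
      then obtain p q where pq: "p \<in> Pos" "q \<in> Neg" "u = f p" "l = f q" by blast
      then have "comb (p, q) \<in> B'" by (auto simp: B'_def)
      then have "fst (comb (p, q)) \<bullet> z \<le> snd (comb (p, q))"
        using z by (cases "comb (p, q)") (auto dest: solsD)
      then have "(fst p \<bullet> v) * (fst q \<bullet> z - snd q) \<le> (fst q \<bullet> v) * (fst p \<bullet> z - snd p)"
        by (simp add: comb_def inner_diff_left inner_add_left algebra_simps)
      moreover have sgn: "fst p \<bullet> v > 0" "fst q \<bullet> v < 0" using pq by (auto simp: Pos_def Neg_def)
      then have "fst p \<bullet> z - snd p = - u * (fst p \<bullet> v)" "fst q \<bullet> z - snd q = - l * (fst q \<bullet> v)"
        using pq by (simp_all add: f_def)
      ultimately have "0 \<le> (l - u) * ((fst p \<bullet> v) * (fst q \<bullet> v))"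
        by (simp add: algebra_simps)
      moreover have "(fst p \<bullet> v) * (fst q \<bullet> v) < 0" using sgn by (rule mult_pos_neg)
      ultimately show "l \<le> u" using zero_le_mult_iff[of "l - u"] by force
    qed (use fin in \<open>auto simp: Pos_def Neg_def\<close>)
    then obtain \<tau> where \<tau>: "\<tau> = 0 \<or> \<tau> \<in> f ` (Neg \<union> Pos)"
      "\<And>p. p \<in> Neg \<Longrightarrow> f p \<le> \<tau>" "\<And>p. p \<in> Pos \<Longrightarrow> \<tau> \<le> f p"
      by auto
    have "z + \<tau> *\<^sub>R v \<in> sols B"
    proof (rule solsI)
      fix a \<beta> assume ab: "(a, \<beta>) \<in> B"
      consider "a \<bullet> v = 0" | "a \<bullet> v > 0" | "a \<bullet> v < 0" by linarith
      then show "a \<bullet> (z + \<tau> *\<^sub>R v) \<le> \<beta>"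
      proof cases
        case 1
        then have "(a, \<beta>) \<in> B'" using ab by (simp add: B'_def)
        from solsD[OF z this] 1 show ?thesis by (simp add: inner_add_right)
      next
        case 2
        then have "\<tau> \<le> f (a, \<beta>)" using ab by (intro \<tau>(3)) (simp add: Pos_def)
        then show ?thesis using 2 by (simp add: f_def inner_add_right field_simps)
      next
        case 3
        then have "f (a, \<beta>) \<le> \<tau>" using ab by (intro \<tau>(2)) (simp add: Neg_def)
        then show ?thesis using 3 by (simp add: f_def inner_add_right field_simps)
      qed
    qed
    moreover have "\<tau> \<in> \<rat>" if "rat_rhs B" "rat_vec z"
    proof -
      have "f p \<in> \<rat>" if "p \<in> B" for p
        using ratB[OF that] \<open>rat_rhs B\<close> \<open>rat_vec z\<close> that unfolding f_def
        by (intro Rats_divide Rats_diff) (auto simp: rat_rhs_def intro: Rats_inner)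
      then show ?thesis using \<tau>(1) subB by auto
    qed
    ultimately show ?thesis by blast
  qed
  show ?thesis
  proof (rule that)
    show "finite B'" using fin by (auto simp: B'_def Pos_def Neg_def)
    show "rat_vec a \<and> der {} B a \<beta> \<and> a \<bullet> v = 0" if "(a, \<beta>) \<in> B'" for a \<beta>
      using elim[OF that] by simp
    show "rat_rhs B'" if "rat_rhs B" using elim that unfolding rat_rhs_def[of B'] by force
  qed (use rev_sol in blast)
qed

text \<open>Repeated elimination of single directions. That the correction \<open>y\<close> lies in
  the span of \<open>V\<close> is expressed dually, through the forms \<open>c\<close> vanishing on
  \<open>V\<close>.\<close>

lemma eliminate_directions:
  fixes B :: "((real^'n) \<times> real) set"
  assumes "finite V" "\<And>v. v \<in> V \<Longrightarrow> rat_vec v"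
    and fin: "finite B" and rat: "\<And>a \<beta>. (a, \<beta>) \<in> B \<Longrightarrow> rat_vec a"
  obtains B' where "finite B'"
    and "\<And>a \<beta>. (a, \<beta>) \<in> B' \<Longrightarrow> rat_vec a \<and> der {} B a \<beta> \<and> (\<forall>v\<in>V. a \<bullet> v = 0)"
    and "rat_rhs B \<Longrightarrow> rat_rhs B'"
    and "\<And>z. z \<in> sols B' \<Longrightarrow> \<exists>y. z + y \<in> sols B \<and>
      (\<forall>c. (\<forall>v\<in>V. c \<bullet> v = 0) \<longrightarrow> c \<bullet> y = 0) \<and> (rat_rhs B \<longrightarrow> rat_vec z \<longrightarrow> rat_vec y)"
  using assms(1,2)
proof (induction V arbitrary: thesis rule: finite_induct)
  case empty
  have "rat_vec (0 :: real^'n)" by (simp add: rat_vec_def)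
  then show ?case
    by (intro empty.prems(1)[OF fin]) (auto intro: der.base rat intro!: exI[of _ 0])
next
  case (insert v V)
  have v: "rat_vec v" and V: "\<And>u. u \<in> V \<Longrightarrow> rat_vec u" using insert.prems(2) by simp_all
  show ?case
  proof (rule insert.IH)
    show "rat_vec u" if "u \<in> V" for u using V that by blast
  next
    fix B' assume B': "finite B'"
      "\<And>a \<beta>. (a, \<beta>) \<in> B' \<Longrightarrow> rat_vec a \<and> der {} B a \<beta> \<and> (\<forall>v\<in>V. a \<bullet> v = 0)"
      "rat_rhs B \<Longrightarrow> rat_rhs B'"
      and rev_sol': "\<And>z. z \<in> sols B' \<Longrightarrow> \<exists>y. z + y \<in> sols B \<and>
         (\<forall>c. (\<forall>v\<in>V. c \<bullet> v = 0) \<longrightarrow> c \<bullet> y = 0) \<and> (rat_rhs B \<longrightarrow> rat_vec z \<longrightarrow> rat_vec y)"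
    obtain B'' where B'': "finite B''"
      "\<And>a \<beta>. (a, \<beta>) \<in> B'' \<Longrightarrow> rat_vec a \<and> der {} B' a \<beta> \<and> a \<bullet> v = 0"
      "rat_rhs B' \<Longrightarrow> rat_rhs B''"
      and rev_sol'': "\<And>z. z \<in> sols B'' \<Longrightarrow> \<exists>\<tau>. z + \<tau> *\<^sub>R v \<in> sols B' \<and>
         (rat_rhs B' \<longrightarrow> rat_vec z \<longrightarrow> \<tau> \<in> \<rat>)"
      by (rule eliminate_direction[OF B'(1) _ v]) (use B'(2) in blast)+
    show ?case
    proof (rule insert.prems(1))
      show "finite B''" by fact
      show "rat_rhs B \<Longrightarrow> rat_rhs B''" using B'(3) B''(3) by blast
    next
      fix a \<beta> assume "(a, \<beta>) \<in> B''"
      then have a: "rat_vec a" "a \<bullet> v = 0" "der {} B' a \<beta>" using B''(2) by auto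
      have "der {} B a \<beta>" by (rule der_trans[OF a(3)]) (use B'(2) in auto)
      moreover have "a \<bullet> u = 0" if "u \<in> V" for u
        by (rule der_orthogonal[OF a(3)]) (use B'(2) that in auto)
      ultimately show "rat_vec a \<and> der {} B a \<beta> \<and> (\<forall>v\<in>insert v V. a \<bullet> v = 0)"
        using a by auto
    next
      fix z assume "z \<in> sols B''"
      then obtain \<tau> where \<tau>: "z + \<tau> *\<^sub>R v \<in> sols B'" "rat_rhs B' \<Longrightarrow> rat_vec z \<Longrightarrow> \<tau> \<in> \<rat>"
        using rev_sol'' by blast
      obtain y where y: "z + \<tau> *\<^sub>R v + y \<in> sols B" "\<And>c. \<forall>v\<in>V. c \<bullet> v = 0 \<Longrightarrow> c \<bullet> y = 0"
        "rat_rhs B \<Longrightarrow> rat_vec (z + \<tau> *\<^sub>R v) \<Longrightarrow> rat_vec y"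
        using rev_sol'[OF \<tau>(1)] by blast
      show "\<exists>y. z + y \<in> sols B \<and> (\<forall>c. (\<forall>v\<in>insert v V. c \<bullet> v = 0) \<longrightarrow> c \<bullet> y = 0) \<and>
         (rat_rhs B \<longrightarrow> rat_vec z \<longrightarrow> rat_vec y)"
        using y \<tau>(2) B'(3) v
        by (intro exI[of _ "\<tau> *\<^sub>R v + y"])
          (auto simp: inner_add_right add.assoc intro!: rat_vec_add rat_vec_scaleR)
    qed
  qed
qed

text \<open>Eliminating the continuous coordinate directions leaves a system supported on
  \<open>I\<close>. Its solutions lift by corrections that vanish on \<open>I\<close>, hence keep
  integrality, so the pure case refutes it.\<close>

theorem refute_mixed:
  fixes B :: "((real^'n) \<times> real) set"
  assumes "finite B" "\<And>a \<beta>. (a, \<beta>) \<in> B \<Longrightarrow> rat_vec a" "\<And>z. z \<in> sols B \<Longrightarrow> \<not> int_on I z"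
  shows "der I B 0 (-1)"
proof -
  let ?V = "(\<lambda>j. axis j 1 :: real^'n) ` (- I)"
  obtain B' where B': "finite B'"
    "\<And>a \<beta>. (a, \<beta>) \<in> B' \<Longrightarrow> rat_vec a \<and> der {} B a \<beta> \<and> (\<forall>v\<in>?V. a \<bullet> v = 0)"
    and "rat_rhs B \<Longrightarrow> rat_rhs B'"
    and rev_sol: "\<And>z. z \<in> sols B' \<Longrightarrow> \<exists>y. z + y \<in> sols B \<and>
       (\<forall>c. (\<forall>v\<in>?V. c \<bullet> v = 0) \<longrightarrow> c \<bullet> y = 0) \<and> (rat_rhs B \<longrightarrow> rat_vec z \<longrightarrow> rat_vec y)"
  proof (rule eliminate_directions[where V = ?V and B = B])
    show "rat_vec v" if "v \<in> ?V" for v using that rat_vec_axis by auto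
    show "rat_vec a" if "(a, \<beta>) \<in> B" for a \<beta> using that assms(2) by auto
  qed (use assms(1) in \<open>simp | (rule that, assumption+)\<close>)+
  have "der I B' 0 (-1)"
  proof (rule refute_pure)
    show "rat_system I B'"
      using B' unfolding rat_system_def by (fastforce simp: inner_axis)
    show "\<forall>z\<in>sols B'. \<not> int_on I z"
    proof (intro ballI notI)
      fix z assume z: "z \<in> sols B'" "int_on I z"
      obtain y where y: "z + y \<in> sols B" "\<And>c. \<forall>v\<in>?V. c \<bullet> v = 0 \<Longrightarrow> c \<bullet> y = 0"
        using rev_sol[OF z(1)] by blast
      have "y $ i = 0" if "i \<in> I" for i
      proof -
        have "axis i 1 \<bullet> y = 0" using that by (intro y(2)) (auto simp: inner_axis_axis)
        then show ?thesis by (simp add: inner_axis')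
      qed
      then have "int_on I (z + y)" using z(2) by (simp add: int_on_def)
      with assms(3) y(1) show False by blast
    qed
  qed simp
  then show ?thesis
    by (rule der_trans) (use B'(2) in \<open>blast intro: der_trans der.base\<close>)+
qed

section \<open>Derived bounds and duality from elimination\<close>

lemma orthogonal_directions:
  fixes h :: "real^'n"
  assumes "h $ k \<noteq> 0" "k \<in> J"
  defines "V \<equiv> (\<lambda>j. axis j 1 - (h $ j / h $ k) *\<^sub>R axis k 1 :: real^'n) ` J"
  shows "(\<forall>v\<in>V. a \<bullet> v = 0) \<longleftrightarrow> (\<forall>j\<in>J. a $ j = (a $ k / h $ k) * h $ j)"
  \<comment> \<open>\<open>V\<close> spans the orthogonal complement of \<open>h\<close> within the
    coordinates \<open>J\<close>. Eliminating it leaves only rows proportional to \<open>h\<close>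
    there, which turns elimination into duality for the objective \<open>h\<close>.\<close>
  by (simp add: V_def inner_diff_right inner_axis field_simps)

text \<open>Each rule transforms the normal in a way that ignores the size of the right-hand side,
  so a derivation from the recession system can be repeated over \<open>B\<close> with other
  bounds.\<close>

lemma der_homogeneous:
  assumes "der I ((\<lambda>(a, \<beta>). (a, 0)) ` B) a \<alpha>"
  shows "\<exists>\<beta>. der I B a \<beta>"
  using assms by induction (auto intro: der.intros)

text \<open>An unbounded form would increase along a rational ray, hence along a ray through
mixed-integral points.\<close>

lemma der_bounded_on_integral_solutions:
  fixes B :: "((real^'n) \<times> real) set"
  assumes fin: "finite B" and rat: "\<And>a \<beta>. (a, \<beta>) \<in> B \<Longrightarrow> rat_vec a"
    and x: "x \<in> sols B" "int_on I x" and d: "rat_vec d"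
    and le: "\<And>z. z \<in> sols B \<Longrightarrow> int_on I z \<Longrightarrow> d \<bullet> z \<le> \<delta>"
  shows "\<exists>\<beta>. der I B d \<beta>"
proof (cases "d = 0")
  case True
  then show ?thesis by (auto intro: der.zero)
next
  case False
  then obtain k where k: "d $ k \<noteq> 0" by (auto simp: vec_eq_iff)
  let ?V = "(\<lambda>j. axis j 1 - (d $ j / d $ k) *\<^sub>R axis k 1 :: real^'n) ` UNIV"
  let ?H = "(\<lambda>(a, \<beta>). (a, 0 :: real)) ` B"
  have "rat_vec v" if "v \<in> ?V" for v
    using that d by (auto intro!: rat_vec_diff rat_vec_scaleR rat_vec_axis simp: rat_vec_def[of d])
  note V = this
  have H: "rat_rhs ?H" by (auto simp: rat_rhs_def)
  obtain B' where
    "finite B'"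
    and B': "\<And>a \<beta>. (a, \<beta>) \<in> B' \<Longrightarrow> rat_vec a \<and> der {} ?H a \<beta> \<and> (\<forall>v\<in>?V. a \<bullet> v = 0)"
    and "rat_rhs ?H \<Longrightarrow> rat_rhs B'"
    and rev_sol: "\<And>z. z \<in> sols B' \<Longrightarrow> \<exists>y. z + y \<in> sols ?H \<and>
       (\<forall>c. (\<forall>v\<in>?V. c \<bullet> v = 0) \<longrightarrow> c \<bullet> y = 0) \<and> (rat_rhs ?H \<longrightarrow> rat_vec z \<longrightarrow> rat_vec y)"
  proof (rule eliminate_directions[where V = ?V and B = ?H])
    show "rat_vec v" if "v \<in> ?V" for v using that V by blast
    show "rat_vec a" if "(a, \<beta>) \<in> ?H" for a \<beta> using that rat by auto
  qed (use fin in \<open>simp | (rule that, assumption+)\<close>)+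
  have par: "a = (a $ k / d $ k) *\<^sub>R d" if "(a, \<beta>) \<in> B'" for a \<beta>
  proof -
    have "\<forall>j. a $ j = (a $ k / d $ k) * d $ j"
      using B'[OF that] orthogonal_directions[OF k UNIV_I, of a] by blast
    then show ?thesis unfolding vec_eq_iff vector_scaleR_component real_scaleR_def .
  qed
  show ?thesis
  proof (cases "\<exists>(a, \<beta>)\<in>B'. a $ k / d $ k > 0")
    case True
    then obtain a \<beta> where ab: "(a, \<beta>) \<in> B'" "a $ k / d $ k > 0" by blast
    define \<kappa> where "\<kappa> = a $ k / d $ k"
    have \<kappa>: "0 < \<kappa>" using ab(2) by (simp add: \<kappa>_def)
    have "der I ?H a \<beta>"
      by (rule der_trans[of "{}"]) (use B'[OF ab(1)] in \<open>auto intro: der.base\<close>)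
    then obtain \<beta>' where "der I B a \<beta>'" using der_homogeneous by blast
    then have "der I B (\<kappa> *\<^sub>R d) \<beta>'" using par[OF ab(1)] by (simp add: \<kappa>_def)
    then have "der I B ((1 / \<kappa>) *\<^sub>R \<kappa> *\<^sub>R d) (1 / \<kappa> * \<beta>')"
      using \<kappa> by (intro der.scale) simp_all
    then show ?thesis using \<kappa> by auto
  next
    case nonpos: False
    \<comment> \<open>With no row a positive multiple of \<open>d\<close>, the vector
      \<open>d\<close> solves the eliminated homogeneous system. It lifts to a rational recession
      direction \<open>d + y\<close> with \<open>d \<bullet> y = 0\<close>, along which the form
      grows by \<open>d \<bullet> d\<close>.\<close>
    have "d \<in> sols B'"
    proof (rule solsI)
      fix a \<beta> assume ab: "(a, \<beta>) \<in> B'"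
      have "0 \<in> sols ?H" by (auto simp: sols_def)
      then have "a \<bullet> 0 \<le> \<beta>"
        using B'[OF ab] der_sound[of "{}" ?H a \<beta> 0] by (auto simp: int_on_def)
      moreover have "a $ k / d $ k \<le> 0" using nonpos ab by (auto simp: not_less)
      then have "(a $ k / d $ k) * (d \<bullet> d) \<le> 0" by (intro mult_nonpos_nonneg) auto
      then have "a \<bullet> d \<le> 0" using arg_cong[OF par[OF ab], of "\<lambda>a. a \<bullet> d"] by simp
      ultimately show "a \<bullet> d \<le> \<beta>" by simp
    qed
    then obtain y where y: "d + y \<in> sols ?H" "\<And>c. \<forall>v\<in>?V. c \<bullet> v = 0 \<Longrightarrow> c \<bullet> y = 0" "rat_vec y"
      using rev_sol d H by blast
    have dy: "d \<bullet> y = 0"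
      using k by (intro y(2)) (auto simp: inner_diff_right inner_axis)
    obtain N :: nat where N: "0 < N" "\<And>i. real N * (d + y) $ i \<in> \<int>"
      using rat_vec_int_multiple[OF rat_vec_add[OF d y(3)]] by blast
    have "d \<bullet> x + real m * (d \<bullet> d) \<le> \<delta>" for m :: nat
    proof -
      let ?z = "x + real (m * N) *\<^sub>R (d + y)"
      have "?z \<in> sols B"
      proof (rule solsI)
        fix a \<beta> assume ab: "(a, \<beta>) \<in> B"
        have "a \<bullet> (d + y) \<le> 0" using ab by (intro solsD[OF y(1)]) force
        then have "real (m * N) * (a \<bullet> (d + y)) \<le> 0" by (intro mult_nonneg_nonpos) auto
        then show "a \<bullet> ?z \<le> \<beta>" using solsD[OF x(1) ab] by (simp add: inner_add_right)
      qed
      moreover have "int_on I ?z"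
      proof -
        have "?z $ i = x $ i + real m * (real N * (d + y) $ i)" for i by simp
        then show ?thesis using x(2) N(2) unfolding int_on_def by (metis Ints_add Ints_mult Ints_of_nat)
      qed
      ultimately have "d \<bullet> ?z \<le> \<delta>" by (rule le)
      then have "d \<bullet> x + real (m * N) * (d \<bullet> d) \<le> \<delta>" using dy by (simp add: inner_add_right)
      moreover have "real m \<le> real (m * N)" using N(1) by (simp del: of_nat_mult)
      then have "real m * (d \<bullet> d) \<le> real (m * N) * (d \<bullet> d)" by (rule mult_right_mono) simp
      ultimately show ?thesis by linarith
    qed
    moreover obtain m :: nat where "(\<delta> - d \<bullet> x) / (d \<bullet> d) < real m"
      using reals_Archimedean2 by blast
    then have "\<delta> - d \<bullet> x < real m * (d \<bullet> d)" using False by (simp add: field_simps)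
    ultimately show ?thesis by (smt (verit))
  qed
qed

text \<open>Some upper bound is derivable, and every slice \<open>d \<bullet> z = t\<close> with
  \<open>t > \<delta>\<close> lacks mixed-integral solutions. Hence \<open>refute_mixed\<close>
  refutes these slices and \<open>der_slices\<close> descends to \<open>\<delta>\<close>.\<close>

theorem der_valid_on_integral_solutions:
  fixes B :: "((real^'n) \<times> real) set" and \<delta> :: int
  assumes fin: "finite B" and rat: "\<And>a \<beta>. (a, \<beta>) \<in> B \<Longrightarrow> rat_vec a"
    and x: "x \<in> sols B" "int_on I x" and d: "int_form I d"
    and le: "\<And>z. z \<in> sols B \<Longrightarrow> int_on I z \<Longrightarrow> d \<bullet> z \<le> of_int \<delta>"
  shows "der I B d (of_int \<delta>)"
proof -
  have drat: "rat_vec d"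
    using d Ints_subset_Rats unfolding int_form_def rat_vec_def by (metis Rats_0 subsetD)
  have "\<exists>\<beta>. der I B d \<beta>"
    by (rule der_bounded_on_integral_solutions[OF fin _ x drat le]) (use rat in auto)
  then obtain \<beta> where "der I B d \<beta>" ..
  with d show ?thesis
  proof (rule der_slices)
    fix t :: int assume t: "\<delta> < t"
    show "der I (insert (d, of_int t) (insert (- d, - of_int t) B)) 0 (-1)"
    proof (rule refute_mixed)
      fix a \<beta> assume "(a, \<beta>) \<in> insert (d, of_int t) (insert (- d, - of_int t) B)"
      then show "rat_vec a" using drat rat by (auto simp: rat_vec_def)
    next
      fix z assume "z \<in> sols (insert (d, of_int t) (insert (- d, - of_int t) B))"
      then have "z \<in> sols B" "of_int t \<le> d \<bullet> z" by (auto simp: sols_def)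
      then show "\<not> int_on I z" using le[of z] t by fastforce
    qed (use fin in auto)
  qed
qed

text \<open>Linear programming duality in the variables outside \<open>I\<close>. Elimination leaves
  rows proportional to \<open>w\<close> on them; optimality of \<open>x\<close> on its fibre makes a
  row with positive factor tight at \<open>x\<close>, and subtracting its normalised form from
  \<open>w\<close> leaves a form \<open>e\<close> in the variables of \<open>I\<close>.\<close>

lemma rational_dual_bound:
  fixes B :: "((real^'n) \<times> real) set"
  assumes fin: "finite B" and rat: "\<And>a \<beta>. (a, \<beta>) \<in> B \<Longrightarrow> rat_vec a" and w: "rat_vec w"
    and x: "x \<in> sols B"
    and opt: "\<And>z. z \<in> sols B \<Longrightarrow> \<forall>i\<in>I. z $ i = x $ i \<Longrightarrow> w \<bullet> z \<le> w \<bullet> x"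
  shows "\<exists>e. rat_vec e \<and> (\<forall>i. i \<notin> I \<longrightarrow> e $ i = 0) \<and> (\<forall>z\<in>sols B. w \<bullet> z \<le> w \<bullet> x + e \<bullet> (z - x))"
proof (cases "\<forall>i. i \<notin> I \<longrightarrow> w $ i = 0")
  case True
  then show ?thesis using w by (intro exI[of _ w]) (auto simp: inner_diff_right)
next
  case False
  then obtain k where k: "w $ k \<noteq> 0" "k \<in> - I" by auto
  let ?V = "(\<lambda>j. axis j 1 - (w $ j / w $ k) *\<^sub>R axis k 1 :: real^'n) ` (- I)"
  have "rat_vec v" if "v \<in> ?V" for v
    using that w by (auto intro!: rat_vec_diff rat_vec_scaleR rat_vec_axis simp: rat_vec_def[of w])
  note V = this
  obtain B' where B': "finite B'"
    "\<And>a \<beta>. (a, \<beta>) \<in> B' \<Longrightarrow> rat_vec a \<and> der {} B a \<beta> \<and> (\<forall>v\<in>?V. a \<bullet> v = 0)"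
    and "rat_rhs B \<Longrightarrow> rat_rhs B'"
    and rev_sol: "\<And>z. z \<in> sols B' \<Longrightarrow> \<exists>y. z + y \<in> sols B \<and>
       (\<forall>c. (\<forall>v\<in>?V. c \<bullet> v = 0) \<longrightarrow> c \<bullet> y = 0) \<and> (rat_rhs B \<longrightarrow> rat_vec z \<longrightarrow> rat_vec y)"
  proof (rule eliminate_directions[where V = ?V and B = B])
    show "rat_vec v" if "v \<in> ?V" for v using that V by blast
    show "rat_vec a" if "(a, \<beta>) \<in> B" for a \<beta> using that rat by auto
  qed (use fin in \<open>simp | (rule that, assumption+)\<close>)+
  have par: "\<forall>j\<in>- I. a $ j = (a $ k / w $ k) * w $ j" if "(a, \<beta>) \<in> B'" for a \<beta>
    using B'(2)[OF that] orthogonal_directions[OF k, of a] by blast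
  have valid: "a \<bullet> z \<le> \<beta>" if "(a, \<beta>) \<in> B'" "z \<in> sols B" for a \<beta> z
    using B'(2)[OF that(1)] that(2) by (auto intro!: der_sound[of "{}" B] simp: int_on_def)
  define h :: "real^'n" where "h = (\<chi> i. if i \<in> I then 0 else w $ i)"
  have ah: "a \<bullet> h = (a $ k / w $ k) * (h \<bullet> h)" if "(a, \<beta>) \<in> B'" for a \<beta>
    using par[OF that] unfolding inner_vec_def sum_distrib_left
    by (intro sum.cong) (auto simp: h_def)
  have wh: "w \<bullet> h = h \<bullet> h"
    unfolding inner_vec_def by (intro sum.cong) (auto simp: h_def)
  have "h \<noteq> 0" using k by (auto simp: h_def vec_eq_iff)
  \<comment> \<open>Otherwise a small step along \<open>h\<close>, the part of \<open>w\<close>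
    outside \<open>I\<close>, stays in \<open>sols B'\<close> and lifts to a point of the same fibre
    with a larger value of \<open>w\<close>.\<close>
  have "\<exists>(a, \<beta>)\<in>B'. a $ k / w $ k > 0 \<and> a \<bullet> x = \<beta>"
  proof (rule ccontr)
    assume none: "\<not> ?thesis"
    have "eventually (\<lambda>\<epsilon>. 0 < \<epsilon> \<and> (\<forall>p\<in>B'. fst p \<bullet> (x + \<epsilon> *\<^sub>R h) \<le> snd p)) (at_right 0)"
    proof (intro eventually_conj eventually_ball_finite[OF B'(1)] ballI)
      show "eventually (\<lambda>\<epsilon>::real. 0 < \<epsilon>) (at_right 0)" by (simp add: eventually_at_right_less)
      fix p assume "p \<in> B'"
      moreover obtain a \<beta> where p: "p = (a, \<beta>)" by (cases p)
      ultimately have ab: "(a, \<beta>) \<in> B'" by simp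
      show "eventually (\<lambda>\<epsilon>. fst p \<bullet> (x + \<epsilon> *\<^sub>R h) \<le> snd p) (at_right 0)"
      proof (cases "a $ k / w $ k > 0")
        case True
        then have "a \<bullet> x < \<beta>" using none ab valid[OF ab x] by force
        moreover have "((\<lambda>\<epsilon>. a \<bullet> (x + \<epsilon> *\<^sub>R h)) \<longlongrightarrow> a \<bullet> (x + 0 *\<^sub>R h)) (at_right 0)"
          by (intro tendsto_intros)
        ultimately have "eventually (\<lambda>\<epsilon>. a \<bullet> (x + \<epsilon> *\<^sub>R h) < \<beta>) (at_right 0)"
          by (intro order_tendstoD(2)) auto
        then show ?thesis using p by (auto elim: eventually_mono)
      next
        case False
        then have "a \<bullet> h \<le> 0" unfolding ah[OF ab] by (intro mult_nonpos_nonneg) auto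
        have "a \<bullet> (x + \<epsilon> *\<^sub>R h) \<le> \<beta>" if "0 < \<epsilon>" for \<epsilon>
          using valid[OF ab x] mult_nonneg_nonpos[OF less_imp_le[OF that] \<open>a \<bullet> h \<le> 0\<close>]
          by (simp add: inner_add_right)
        then show ?thesis using p eventually_at_right_less[of "0::real"] by (auto elim: eventually_mono)
      qed
    qed
    then obtain \<epsilon> where \<epsilon>: "0 < \<epsilon>" "\<forall>p\<in>B'. fst p \<bullet> (x + \<epsilon> *\<^sub>R h) \<le> snd p"
      using eventually_happens'[OF trivial_limit_at_right_real] by blast
    then have "x + \<epsilon> *\<^sub>R h \<in> sols B'" by (auto intro!: solsI)
    then obtain y where y: "x + \<epsilon> *\<^sub>R h + y \<in> sols B" "\<And>c. \<forall>v\<in>?V. c \<bullet> v = 0 \<Longrightarrow> c \<bullet> y = 0"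
      using rev_sol by blast
    have "y $ i = 0" if "i \<in> I" for i
    proof -
      have "axis i 1 \<bullet> y = 0"
        using that k(2) by (intro y(2)) (auto simp: inner_axis_axis inner_diff_right)
      then show ?thesis by (simp add: inner_axis')
    qed
    then have "\<forall>i\<in>I. (x + \<epsilon> *\<^sub>R h + y) $ i = x $ i" by (simp add: h_def)
    from opt[OF y(1) this] have "w \<bullet> x + \<epsilon> * (h \<bullet> h) + w \<bullet> y \<le> w \<bullet> x"
      by (simp add: inner_add_right wh)
    moreover have "w \<bullet> y = 0"
      using k by (intro y(2)) (auto simp: inner_diff_right inner_axis)
    moreover have "0 < \<epsilon> * (h \<bullet> h)" using \<epsilon>(1) \<open>h \<noteq> 0\<close> by simp
    ultimately show False by simp
  qed
  then obtain a \<beta> where ab: "(a, \<beta>) \<in> B'" "a $ k / w $ k > 0" "a \<bullet> x = \<beta>" by blast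
  define \<kappa> where "\<kappa> = a $ k / w $ k"
  have \<kappa>: "0 < \<kappa>" "\<kappa> \<in> \<rat>" using ab B'(2)[OF ab(1)] w by (auto simp: \<kappa>_def rat_vec_def)
  define e where "e = w - (1 / \<kappa>) *\<^sub>R a"
  have "rat_vec e" unfolding e_def
    using \<kappa> B'(2)[OF ab(1)] w by (intro rat_vec_diff rat_vec_scaleR) auto
  moreover have "e $ i = 0" if "i \<notin> I" for i
    using par[OF ab(1)] that \<kappa>(1) by (simp add: e_def \<kappa>_def[symmetric])
  moreover have "w \<bullet> z \<le> w \<bullet> x + e \<bullet> (z - x)" if "z \<in> sols B" for z
  proof -
    have "a \<bullet> z \<le> a \<bullet> x" using valid[OF ab(1) that] ab(3) by simp
    then have "a \<bullet> z / \<kappa> \<le> a \<bullet> x / \<kappa>" using \<kappa>(1) by (simp add: divide_right_mono)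
    then show ?thesis by (simp add: e_def inner_diff_left inner_diff_right)
  qed
  ultimately show ?thesis by blast
qed

section \<open>Tilting a valid inequality\<close>

text \<open>This is \<open>der_split_iter\<close> with the error term \<open>\<mu> * u - s\<close>.
  The numbers \<open>k\<close> and \<open>\<rho>\<close> are fixed before \<open>C\<close> and
  \<open>\<mu>\<close>, so the slope drops by the same amount in every round.\<close>

lemma tilt_step:
  fixes w d :: "real^'n"
  assumes "der I B d \<delta>" "0 \<le> R"
    and s: "\<And>z. s z = w \<bullet> z - \<gamma>" and u: "\<And>z. u z = d \<bullet> z - \<delta>"
  shows "\<exists>k \<rho>. 0 < \<rho> \<and> (\<forall>C \<mu>. (\<forall>z\<in>C. s z \<le> \<mu> * u z \<and>
      (\<forall>b \<beta>. (b, \<beta>) \<in> B \<longrightarrow> b \<bullet> z \<le> \<beta> + R * (\<mu> * u z - s z))) \<longrightarrow>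
      (\<forall>z\<in>split_iter I k C. s z \<le> (\<mu> - 1 / \<rho>) * u z))"
proof -
  obtain k \<rho> where \<rho>: "0 \<le> \<rho>" "\<forall>C g g0. small_error B R C g g0 \<longrightarrow>
      (\<forall>z\<in>split_iter I k C. d \<bullet> z \<le> \<delta> + \<rho> * (g \<bullet> z + g0))"
    using der_split_iter[OF assms(1,2)] by blast
  show ?thesis
  \<comment> \<open>\<open>\<rho>\<close> may be 0; adding 1 permits the division and only adds one
    more copy of the nonnegative slack.\<close>
  proof (intro exI[of _ k] exI[of _ "\<rho> + 1"] conjI allI impI ballI)
    show "0 < \<rho> + 1" using \<rho>(1) by simp
    fix C :: "(real^'n) set" and \<mu> z
    assume C: "\<forall>z\<in>C. s z \<le> \<mu> * u z \<and>
      (\<forall>b \<beta>. (b, \<beta>) \<in> B \<longrightarrow> b \<bullet> z \<le> \<beta> + R * (\<mu> * u z - s z))"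
      and z: "z \<in> split_iter I k C"
    define g where "g = \<mu> *\<^sub>R d - w"
    define g0 where "g0 = \<gamma> - \<mu> * \<delta>"
    have g: "g \<bullet> y + g0 = \<mu> * u y - s y" for y
      by (simp add: g_def g0_def s u inner_diff_left algebra_simps)
    have "small_error B R C g g0"
      unfolding small_error_def g using C by auto
    with \<rho>(2) z have "d \<bullet> z \<le> \<delta> + \<rho> * (g \<bullet> z + g0)" by blast
    then have "u z \<le> \<rho> * (\<mu> * u z - s z)" by (simp add: g u)
    moreover have "s z \<le> \<mu> * u z" using C z split_iter_subset by blast
    ultimately have "u z \<le> (\<rho> + 1) * (\<mu> * u z - s z)" by (simp add: distrib_right)
    then have "u z / (\<rho> + 1) \<le> \<mu> * u z - s z"
      using \<rho>(1) by (simp add: divide_le_eq mult.commute)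
    then show "s z \<le> (\<mu> - 1 / (\<rho> + 1)) * u z"
      by (simp add: left_diff_distrib)
  qed
qed

text \<open>Lowering the slope below zero is harmless: at nonpositive \<open>u\<close> the initial slope
\<open>\<mu>0\<close> gives the stronger bound.\<close>

lemma slope_max:
  fixes s u :: real
  assumes "s \<le> \<mu>0 * u" "s \<le> \<mu> * u" "\<mu> \<le> \<mu>0" "0 \<le> \<mu>0"
  shows "s \<le> max 0 \<mu> * u"
proof (cases "u \<ge> 0")
  case True
  have "\<mu> * u \<le> max 0 \<mu> * u" using True by (intro mult_right_mono) auto
  then show ?thesis using assms(2) by linarith
next
  case False
  have "\<mu>0 * u \<le> max 0 \<mu> * u" using False assms by (intro mult_right_mono_neg) auto
  then show ?thesis using assms(1) by linarith
qed

text \<open>\<open>face\<close> lowers the slope once, from \<open>\<mu>0\<close> to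
  \<open>\<mu>1\<close>. The gap gained bounds \<open>- s\<close> by a multiple of the error for all
  slopes in \<open>[0, \<mu>1]\<close>, so that \<open>level\<close> serves all further rounds with
  one common decrement.\<close>

lemma split_iter_descent:
  fixes w d :: "real^'n" and F :: "((real^'n) \<times> real) set"
  assumes "0 < \<mu>0" and bound: "\<And>z. z \<in> sols F \<Longrightarrow> w \<bullet> z - \<gamma> \<le> \<mu>0 * (d \<bullet> z - \<delta>)"
    and face: "der I (insert (\<mu>0 *\<^sub>R d - w, \<mu>0 * \<delta> - \<gamma>) F) d \<delta>"
    and level: "der I (insert (- w, - \<gamma>) F) d \<delta>"
  shows "\<exists>k. \<forall>z\<in>split_iter I k (sols F). w \<bullet> z \<le> \<gamma>"
proof -
  define s where "s z = w \<bullet> z - \<gamma>" for z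
  define u where "u z = d \<bullet> z - \<delta>" for z
  let ?P = "\<lambda>k. split_iter I k (sols F)"
  have sub: "z \<in> sols F" if "z \<in> ?P k" for z k
    using that split_iter_subset by blast
  have bound0: "s z \<le> \<mu>0 * u z" if "z \<in> sols F" for z
    using bound[OF that] by (simp add: s_def u_def)
  obtain k1 :: nat and \<rho>1 where \<rho>1: "0 < \<rho>1" and step1: "\<forall>C \<mu>. (\<forall>z\<in>C. s z \<le> \<mu> * u z \<and>
      (\<forall>b \<beta>. (b, \<beta>) \<in> insert (\<mu>0 *\<^sub>R d - w, \<mu>0 * \<delta> - \<gamma>) F \<longrightarrow>
        b \<bullet> z \<le> \<beta> + 1 * (\<mu> * u z - s z))) \<longrightarrow>
      (\<forall>z\<in>split_iter I k1 C. s z \<le> (\<mu> - 1 / \<rho>1) * u z)"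
    using tilt_step[OF face zero_le_one s_def u_def] by blast
  define \<mu>1 where "\<mu>1 = max 0 (\<mu>0 - 1 / \<rho>1)"
  have \<mu>1: "0 \<le> \<mu>1" "\<mu>1 < \<mu>0" using \<rho>1 \<open>0 < \<mu>0\<close> by (auto simp: \<mu>1_def)
  have first: "s z \<le> \<mu>1 * u z" if "z \<in> ?P k1" for z
    unfolding \<mu>1_def
  proof (rule slope_max[OF bound0[OF sub[OF that]]])
    show "s z \<le> (\<mu>0 - 1 / \<rho>1) * u z"
    proof (rule step1[rule_format, OF conjI[OF bound0] that], assumption, intro allI impI)
      fix z b \<beta> assume z: "z \<in> sols F" and b: "(b, \<beta>) \<in> insert (\<mu>0 *\<^sub>R d - w, \<mu>0 * \<delta> - \<gamma>) F"
      \<comment> \<open>At slope \<open>\<mu>0\<close> the left side of the adjoined face inequality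
        exceeds its right side by exactly the error term, so the ratio 1 is enough.\<close>
      show "b \<bullet> z \<le> \<beta> + 1 * (\<mu>0 * u z - s z)"
      proof (cases "(b, \<beta>) \<in> F")
        case True
        then show ?thesis using solsD[OF z True] bound0[OF z] by simp
      next
        case False
        then have "b = \<mu>0 *\<^sub>R d - w" "\<beta> = \<mu>0 * \<delta> - \<gamma>" using b by auto
        then have "b \<bullet> z - \<beta> = \<mu>0 * u z - s z"
          by (simp only: s_def u_def inner_diff_left inner_scaleR_left) (simp add: algebra_simps)
        then show ?thesis by simp
      qed
    qed
  qed (use \<rho>1 \<open>0 < \<mu>0\<close> in auto)
  \<comment> \<open>Let \<open>g = \<mu> * u - s\<close>. For \<open>u < 0\<close> and
    \<open>\<mu> \<le> \<mu>1\<close> the initial bound gives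
    \<open>(\<mu>0 - \<mu>1) * - u \<le> g\<close>, so that \<open>- s = g - \<mu> * u\<close> is at
    most \<open>R * g\<close>.\<close>
  define R where "R = 1 + \<mu>1 / (\<mu>0 - \<mu>1)"
  have R: "0 \<le> R" "1 \<le> R" using \<mu>1 by (auto simp: R_def)
  obtain k2 :: nat and \<rho> where \<rho>: "0 < \<rho>" and step2: "\<forall>C \<mu>. (\<forall>z\<in>C. s z \<le> \<mu> * u z \<and>
      (\<forall>b \<beta>. (b, \<beta>) \<in> insert (- w, - \<gamma>) F \<longrightarrow> b \<bullet> z \<le> \<beta> + R * (\<mu> * u z - s z))) \<longrightarrow>
      (\<forall>z\<in>split_iter I k2 C. s z \<le> (\<mu> - 1 / \<rho>) * u z)"
    using tilt_step[OF level R(1) s_def u_def] by blast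
  have descent: "\<exists>k. \<forall>z\<in>?P k. s z \<le> max 0 (\<mu>1 - real m / \<rho>) * u z" for m :: nat
  proof (induction m)
    case 0
    then show ?case using first \<mu>1 by (intro exI[of _ k1]) (simp add: max_absorb2)
  next
    case (Suc m)
    define \<mu> where "\<mu> = max 0 (\<mu>1 - real m / \<rho>)"
    have \<mu>: "0 \<le> \<mu>" "\<mu> \<le> \<mu>1" using \<mu>1 \<rho> by (auto simp: \<mu>_def)
    obtain k where k: "\<And>z. z \<in> ?P k \<Longrightarrow> s z \<le> \<mu> * u z" using Suc.IH by (auto simp: \<mu>_def)
    have level_err: "- s z \<le> R * (\<mu> * u z - s z)" if z: "z \<in> ?P k" for z
    proof -
      define g where "g = \<mu> * u z - s z"
      have g: "0 \<le> g" using k[OF z] by (simp add: g_def)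
      have "- (\<mu> * u z) \<le> \<mu>1 / (\<mu>0 - \<mu>1) * g"
      proof (cases "0 \<le> u z")
        case True
        then have "0 \<le> \<mu> * u z" "0 \<le> \<mu>1 / (\<mu>0 - \<mu>1) * g" using \<mu> \<mu>1 g by auto
        then show ?thesis by linarith
      next
        case False
        have "(\<mu>0 - \<mu>1) * - u z \<le> (\<mu>0 - \<mu>) * - u z"
          using False \<mu> by (intro mult_right_mono) auto
        also have "\<dots> \<le> g" using bound0[OF sub[OF z]] by (simp add: g_def algebra_simps)
        finally have "- u z \<le> g / (\<mu>0 - \<mu>1)" using \<mu>1 by (simp add: le_divide_eq mult.commute)
        then have "\<mu>1 * - u z \<le> \<mu>1 * (g / (\<mu>0 - \<mu>1))" using \<mu>1 by (intro mult_left_mono)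
        moreover have "\<mu> * - u z \<le> \<mu>1 * - u z" using False \<mu> by (intro mult_right_mono) auto
        ultimately show ?thesis by simp
      qed
      then show ?thesis unfolding R_def g_def[symmetric] by (simp add: g_def distrib_right)
    qed
    show ?case
    proof (intro exI[of _ "k + k2"] ballI)
      fix z assume "z \<in> ?P (k + k2)"
      then have z: "z \<in> split_iter I k2 (?P k)" by (simp add: split_iter_add)
      then have zF: "z \<in> sols F" using split_iter_subset by blast
      have "s z \<le> (\<mu> - 1 / \<rho>) * u z"
      proof (rule step2[rule_format, OF conjI[OF k] z], assumption, intro allI impI)
        fix z b \<beta> assume z: "z \<in> ?P k" and b: "(b, \<beta>) \<in> insert (- w, - \<gamma>) F"
        show "b \<bullet> z \<le> \<beta> + R * (\<mu> * u z - s z)"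
        proof (cases "(b, \<beta>) \<in> F")
          case True
          have "0 \<le> R * (\<mu> * u z - s z)" using R(1) k[OF z] by simp
          then show ?thesis using solsD[OF sub[OF z] True] by simp
        next
          case False
          then have "b \<bullet> z = \<beta> - s z" using b by (simp add: s_def)
          then show ?thesis using level_err[OF z] by simp
        qed
      qed
      then have "s z \<le> max 0 (\<mu> - 1 / \<rho>) * u z"
        using \<mu> \<mu>1 \<rho> by (intro slope_max[OF bound0[OF zF]]) (auto intro: order_trans[of _ \<mu>])
      also have "max 0 (\<mu> - 1 / \<rho>) = max 0 (\<mu>1 - real (Suc m) / \<rho>)"
      proof -
        have "0 < 1 / \<rho>" "real (Suc m) / \<rho> = 1 / \<rho> + real m / \<rho>"
          using \<rho> by (simp_all add: add_divide_distrib)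
        then show ?thesis unfolding \<mu>_def by linarith
      qed
      finally show "s z \<le> max 0 (\<mu>1 - real (Suc m) / \<rho>) * u z" .
    qed
  qed
  obtain m :: nat where "\<mu>1 * \<rho> < real m" using reals_Archimedean2 by blast
  then have "max 0 (\<mu>1 - real m / \<rho>) = 0" using \<rho> by (simp add: max_def field_simps)
  then show ?thesis using descent[of m] by (auto simp: s_def)
qed

section \<open>Choice of the integral form and value of the supremum\<close>

lemma convex_sols: "convex (sols B)"
proof -
  have "sols B = (\<Inter>p\<in>B. {z. fst p \<bullet> z \<le> snd p})" by (auto simp: sols_def case_prod_beta)
  then show ?thesis by (auto intro: convex_INT convex_halfspace_le)
qed

theorem theorem2p8:
  fixes P :: "(real^'n) set" and I :: "'n set" and w :: "real^'n"
  assumes "rational_polyhedron P"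
    and "mi_hull I P \<noteq> {}"
    and "rat_vec w"
    and "bdd_above ((\<lambda>z. w \<bullet> z) ` P)"
    and "\<gamma> = Sup ((\<lambda>z. w \<bullet> z) ` mi_hull I P)"
    and "M = {z \<in> mi_hull I P. w \<bullet> z = \<gamma>}"
    and "\<exists>z \<in> rel_interior (proj_X I M). int_on I z"
  shows "\<exists>k::nat. Sup ((\<lambda>z. w \<bullet> z) ` split_iter I k P) = \<gamma>"
proof -
  obtain F where F: "finite F" "\<And>a \<beta>. (a, \<beta>) \<in> F \<Longrightarrow> rat_vec a" and P: "P = sols F"
    using assms(1) unfolding rational_polyhedron_def sols_def by blast
  have hull: "mi_hull I P \<subseteq> P"
    unfolding mi_hull_def by (rule hull_minimal) (auto simp: P convex_sols)
  have int_hull: "z \<in> mi_hull I P" if "z \<in> P" "int_on I z" for z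
    unfolding mi_hull_def using that by (intro hull_inc) simp
  have int_le: "w \<bullet> z \<le> \<gamma>" if "z \<in> P" "int_on I z" for z
    unfolding assms(5)
    by (rule cSup_upper[OF imageI[OF int_hull[OF that]] bdd_above_mono[OF assms(4)]])
      (use hull in auto)
  define pr :: "real^'n \<Rightarrow> real^'n" where "pr = (\<lambda>z. \<chi> i. if i \<in> I then z $ i else 0)"
  have proj: "proj_X I M = pr ` M" by (simp add: proj_X_def pr_def)
  have lin: "linear pr" by (rule linearI) (auto simp: pr_def vec_eq_iff)
  obtain x where x: "x \<in> rel_interior (pr ` M)" "int_on I x"
    using assms(7) proj by auto
  then obtain x' where x': "x' \<in> M" "x = pr x'" using rel_interior_subset by blast
  have x'P: "x' \<in> P" "w \<bullet> x' = \<gamma>" "x' \<in> mi_hull I P" using x'(1) hull by (auto simp: assms(6))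
  have x'int: "int_on I x'" using x(2) x'(2) by (simp add: int_on_def pr_def)
  \<comment> \<open>Every point of \<open>P\<close> on the fibre of \<open>x'\<close> is
    mixed-integral and so has value at most \<open>\<gamma>\<close>; thus \<open>x'\<close> is
    optimal on its fibre.\<close>
  have "\<exists>e. rat_vec e \<and> (\<forall>i. i \<notin> I \<longrightarrow> e $ i = 0) \<and> (\<forall>z\<in>sols F. w \<bullet> z \<le> w \<bullet> x' + e \<bullet> (z - x'))"
  proof (rule rational_dual_bound[OF F(1) _ assms(3)])
    show "rat_vec a" if "(a, \<beta>) \<in> F" for a \<beta> using F(2) that by blast
    show "x' \<in> sols F" using x'P by (simp add: P)
    fix z assume z: "z \<in> sols F" "\<forall>i\<in>I. z $ i = x' $ i"
    then have "int_on I z" using x'int by (simp add: int_on_def)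
    then show "w \<bullet> z \<le> w \<bullet> x'" using int_le z(1) x'P by (simp add: P)
  qed
  then obtain e where e: "rat_vec e" "\<And>i. i \<notin> I \<Longrightarrow> e $ i = 0"
    "\<And>z. z \<in> P \<Longrightarrow> w \<bullet> z \<le> \<gamma> + e \<bullet> (z - x')"
    using x'P P by auto
  obtain N :: nat where N: "0 < N" "\<And>i. real N * e $ i \<in> \<int>"
    using rat_vec_int_multiple[OF e(1)] by blast
  \<comment> \<open>Clearing denominators makes the dual form an admissible split direction; the
    slope \<open>1 / N\<close> compensates for the scaling.\<close>
  define d where "d = real N *\<^sub>R e"
  define \<mu>0 where "\<mu>0 = 1 / real N"
  have d: "int_form I d" using N e(2) by (auto simp: int_form_def d_def)
  have \<mu>0: "0 < \<mu>0" "\<mu>0 \<in> \<rat>" and e_eq: "e = \<mu>0 *\<^sub>R d" using N by (auto simp: \<mu>0_def d_def)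
  obtain \<delta> :: int where \<delta>: "d \<bullet> x' = of_int \<delta>"
    using inner_int_form[OF d x'int] by (auto elim: Ints_cases)
  have bound: "w \<bullet> z - \<gamma> \<le> \<mu>0 * (d \<bullet> z - of_int \<delta>)" if "z \<in> sols F" for z
    using e(3)[of z] that by (simp add: P e_eq inner_diff_right \<delta> right_diff_distrib)
  have d_pr: "d \<bullet> pr z = d \<bullet> z" for z
    unfolding inner_vec_def using d by (intro sum.cong) (auto simp: pr_def int_form_def)
  \<comment> \<open>On \<open>M\<close> the objective equals \<open>\<gamma>\<close>, so
    \<open>bound\<close> reads \<open>0 \<le> \<mu>0 * u\<close> there.\<close>
  have d_ge: "of_int \<delta> \<le> d \<bullet> z" if "z \<in> M" for z
  proof -
    have "0 \<le> \<mu>0 * (d \<bullet> z - of_int \<delta>)"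
      using that hull bound[of z] by (auto simp: assms(6) P)
    then show ?thesis using \<mu>0(1) by (simp add: zero_le_mult_iff)
  qed
  have "convex M"
    unfolding assms(6) mi_hull_def
    using convex_Int[OF convex_convex_hull convex_hyperplane[of w \<gamma>]] by (simp add: Int_def)
  then have conv: "convex (pr ` M)" using lin by (rule convex_linear_image[rotated])
  \<comment> \<open>\<open>d\<close> attains its minimum over \<open>M\<close> in the relative interior, so it is constant on \<open>M\<close>.\<close>
  have d_le: "d \<bullet> z \<le> of_int \<delta>" if "z \<in> M" for z
  proof -
    have "pr ` M \<noteq> {}" "pr z \<in> pr ` M" using that by auto
    then obtain t where t: "t > 1" "(1 - t) *\<^sub>R pr z + t *\<^sub>R x \<in> pr ` M"
      using x(1) unfolding convex_rel_interior_iff[OF conv \<open>pr ` M \<noteq> {}\<close>] by blast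
    then obtain y where y: "y \<in> M" "(1 - t) *\<^sub>R pr z + t *\<^sub>R x = pr y" by blast
    have "of_int \<delta> \<le> d \<bullet> pr y" using d_ge[OF y(1)] by (simp add: d_pr)
    also have "\<dots> = (1 - t) * (d \<bullet> z) + t * of_int \<delta>"
      unfolding y(2)[symmetric] x'(2) by (simp add: inner_add_right d_pr \<delta>)
    finally have "0 \<le> (t - 1) * (of_int \<delta> - d \<bullet> z)" by (simp add: algebra_simps)
    then show ?thesis using t(1) by (simp add: zero_le_mult_iff)
  qed
  have d_rat: "rat_vec d"
    using rat_vec_scaleR[OF _ e(1), of "real N"] by (simp add: d_def)
  \<comment> \<open>Mixed-integral points on the face satisfy
    \<open>\<mu>0 * u \<le> s \<le> 0\<close>, hence \<open>u \<le> 0\<close>.\<close>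
  have "der I (insert (\<mu>0 *\<^sub>R d - w, \<mu>0 * of_int \<delta> - \<gamma>) F) d (of_int \<delta>)"
  proof (rule der_valid_on_integral_solutions[where x = x'])
    show "rat_vec a" if "(a, \<beta>) \<in> insert (\<mu>0 *\<^sub>R d - w, \<mu>0 * of_int \<delta> - \<gamma>) F" for a \<beta>
      using that F(2) assms(3) \<mu>0(2) d_rat by (auto intro!: rat_vec_diff rat_vec_scaleR)
    show "x' \<in> sols (insert (\<mu>0 *\<^sub>R d - w, \<mu>0 * of_int \<delta> - \<gamma>) F)"
      using x'P by (auto simp: P sols_def inner_diff_left \<delta>)
    fix z assume z: "z \<in> sols (insert (\<mu>0 *\<^sub>R d - w, \<mu>0 * of_int \<delta> - \<gamma>) F)" "int_on I z"
    then have "z \<in> P" "\<mu>0 * (d \<bullet> z - of_int \<delta>) \<le> w \<bullet> z - \<gamma>"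
      by (auto simp: P sols_def inner_diff_left algebra_simps)
    then have "\<mu>0 * (d \<bullet> z - of_int \<delta>) \<le> 0" using int_le z(2) by fastforce
    then show "d \<bullet> z \<le> of_int \<delta>" using \<mu>0(1) by (simp add: mult_le_0_iff)
  qed (use F(1) x'int d in auto)
  \<comment> \<open>Mixed-integral points of \<open>P\<close> with \<open>s \<ge> 0\<close> lie in
    \<open>M\<close>, where \<open>d_le\<close> applies.\<close>
  moreover have "der I (insert (- w, - \<gamma>) F) d (of_int \<delta>)"
  proof (rule der_valid_on_integral_solutions[where x = x'])
    show "rat_vec a" if "(a, \<beta>) \<in> insert (- w, - \<gamma>) F" for a \<beta>
      using that F(2) assms(3) by (auto simp: rat_vec_def)
    show "x' \<in> sols (insert (- w, - \<gamma>) F)"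
      using x'P by (auto simp: P sols_def)
    fix z assume z: "z \<in> sols (insert (- w, - \<gamma>) F)" "int_on I z"
    then have "z \<in> P" "\<gamma> \<le> w \<bullet> z" by (auto simp: P sols_def)
    then have "z \<in> M" using int_le[of z] int_hull[of z] z(2) by (auto simp: assms(6))
    then show "d \<bullet> z \<le> of_int \<delta>" by (rule d_le)
  qed (use F(1) x'int d in auto)
  ultimately obtain k where k: "\<forall>z\<in>split_iter I k P. w \<bullet> z \<le> \<gamma>"
    using split_iter_descent[OF \<mu>0(1) bound] unfolding P by blast
  have "Sup ((\<lambda>z. w \<bullet> z) ` split_iter I k P) = \<gamma>"
  proof (rule cSup_eq_maximum)
    \<comment> \<open>The value is attained at \<open>x'\<close>, which is mixed-integral and
      survives every round.\<close>
    show "\<gamma> \<in> (\<lambda>z. w \<bullet> z) ` split_iter I k P"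
      using int_on_in_split_iter[OF x'P(1) x'int, of k] x'P(2) by force
  qed (use k in auto)
  then show ?thesis ..
qed

end
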